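(* Suppose that the system $\Sigma(A,B,B^* )$ on a Hilbert space $\mathcal Z$ is minimal and collocated self-adjoint. Then each root locus function $f_n(k)$, $k\ge 0$, is real-valued, and all the zeros of the system are real and interlace with the eigenvalues of $A$. If the state space $\mathcal Z$ is infinite-dimensional, then the root locus has no asymptote (no branch satisfies $|f_n(k)|\to\infty$), and each branch $f_n$ converges to the left to a zero of the system as $k\to\infty$.
   Context: $\mathcal Z$ is a complex Hilbert space. A system $\Sigma(A,B,C)$ consists of the generator $A:D(A)\subset\mathcal Z\to\mathcal Z$ of a $C_0$-semigroup on $\mathcal Z$ and bounded operators $B:\mathbb C\to\mathcal Z$, $Bu=bu$, and $C:\mathcal Z\to\mathbb C$, $Cx=\langle x,c\rangle$, with $b,c\in\mathcal Z$ and $B,C\neq0$. Standing assumption: $\sigma(A)$ is non-empty and consists only of isolated eigenvalues with finite algebraic multiplicity (so $\sigma(A)$ is finite or countable without finite accumulation point). The system is collocated self-adjoint if $A$ is self-adjoint and $C=B^*$ (i.e. $c=b$). An invariant zero is a $\lambda\in\mathbb C$ for which there are a non-zero $x\in D(A)$ and a scalar $u$ with $(\lambda I-A)x-Bu=0$ and $Cx=0$. The system is minimal if no invariant zero belongs to $\sigma(A)$. For a minimal system the invariant zeros coincide with the transmission zeros, i.e. the $s\in\rho(A)$ with $G(s)=C(sI-A)^{-1}B=0$; these are the "zeros". "Interlace" means that zeros and eigenvalues alternate along the line. Root locus: let $\{\lambda_n\}$ be the eigenvalues of $A$ counted with multiplicity. The root locus is the family of curves (branches) $f_n:[0,\infty)\to\mathbb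 C$ with $f_n(0)=\lambda_n$, whose values $f_n(k)$ are the eigenvalues of $A-kBC$ (here $A-kBB^*$). *)

theory Defs
  imports "HOL-Analysis.Analysis"
begin

section \<open>Complex Hilbert spaces\<close>

text \<open>The inner product is linear in its first argument. Positive definiteness is not a separate
  axiom: it follows from \<open>cinner_self\<close> and the norm axioms of \<^class>\<open>real_normed_vector\<close>.\<close>

class complex_hilbert = banach +
  fixes scaleC :: "complex \<Rightarrow> 'a \<Rightarrow> 'a" (infixr \<open>*\<^sub>C\<close> 75)
    and cinner :: "'a \<Rightarrow> 'a \<Rightarrow> complex"
  assumes scaleR_eq_scaleC: "r *\<^sub>R x = complex_of_real r *\<^sub>C x"
    and scaleC_add_right: "a *\<^sub>C (x + y) = a *\<^sub>C x + a *\<^sub>C y"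
    and scaleC_add_left: "(a + a') *\<^sub>C x = a *\<^sub>C x + a' *\<^sub>C x"
    and scaleC_scaleC: "a *\<^sub>C a' *\<^sub>C x = (a * a') *\<^sub>C x"
    and cinner_commute: "cinner x y = cnj (cinner y x)"
    and cinner_add_left: "cinner (x + y) z = cinner x z + cinner y z"
    and cinner_scaleC_left: "cinner (a *\<^sub>C x) y = a * cinner x y"
    and cinner_self: "cinner x x = complex_of_real ((norm x)\<^sup>2)"

lemma scaleC_one: "1 *\<^sub>C x = (x :: 'a :: complex_hilbert)"
  using scaleR_eq_scaleC[of 1 x] by simp

global_interpretation complex_vector:
  vector_space "scaleC :: complex \<Rightarrow> 'a \<Rightarrow> 'a :: complex_hilbert"
  by unfold_locales (simp_all add: scaleC_add_right scaleC_add_left scaleC_scaleC scaleC_one)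

instantiation complex :: complex_hilbert
begin

definition scaleC_complex :: "complex \<Rightarrow> complex \<Rightarrow> complex"
  where "scaleC_complex a z = a * z"

definition cinner_complex :: "complex \<Rightarrow> complex \<Rightarrow> complex"
  where "cinner_complex z w = z * cnj w"

instance
  by standard
    (simp_all only: scaleC_complex_def cinner_complex_def,
      auto simp: scaleR_conv_of_real algebra_simps complex_norm_square [symmetric])

end

definition bounded_clinear :: "('a :: complex_hilbert \<Rightarrow> 'b :: complex_hilbert) \<Rightarrow> bool"
  where "bounded_clinear F \<longleftrightarrow> bounded_linear F \<and> (\<forall>a x. F (a *\<^sub>C x) = a *\<^sub>C F x)"

definition finite_dimensional :: "'a :: complex_hilbert set \<Rightarrow> bool"
  where "finite_dimensional V \<longleftrightarrow> (\<exists>S. finite S \<and> V \<subseteq> complex_vector.span S)"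


section \<open>Unbounded operators\<close>

text \<open>An operator with domain \<open>D\<close> is a pair \<open>D\<close>, \<open>A\<close>, where only the values of \<open>A\<close> on \<open>D\<close> matter.\<close>

definition linear_operator :: "'a :: complex_hilbert set \<Rightarrow> ('a \<Rightarrow> 'a) \<Rightarrow> bool"
  where "linear_operator D A \<longleftrightarrow> complex_vector.subspace D \<and>
    (\<forall>x\<in>D. \<forall>y\<in>D. A (x + y) = A x + A y) \<and> (\<forall>a. \<forall>x\<in>D. A (a *\<^sub>C x) = a *\<^sub>C A x)"

definition c0_semigroup :: "(real \<Rightarrow> 'a :: complex_hilbert \<Rightarrow> 'a) \<Rightarrow> bool"
  where "c0_semigroup T \<longleftrightarrow>
    (\<forall>t\<ge>0. bounded_clinear (T t)) \<and>
    T 0 = id \<and>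
    (\<forall>s\<ge>0. \<forall>t\<ge>0. T (s + t) = T s \<circ> T t) \<and>
    (\<forall>x. ((\<lambda>t. T t x) \<longlongrightarrow> x) (at_right 0))"

definition is_generator_of ::
    "'a :: complex_hilbert set \<Rightarrow> ('a \<Rightarrow> 'a) \<Rightarrow> (real \<Rightarrow> 'a \<Rightarrow> 'a) \<Rightarrow> bool"
  where "is_generator_of D A T \<longleftrightarrow>
    (\<forall>x y. x \<in> D \<and> A x = y \<longleftrightarrow> ((\<lambda>t. (1 / t) *\<^sub>R (T t x - x)) \<longlongrightarrow> y) (at_right 0))"

definition generates_c0_semigroup :: "'a :: complex_hilbert set \<Rightarrow> ('a \<Rightarrow> 'a) \<Rightarrow> bool"
  where "generates_c0_semigroup D A \<longleftrightarrow> (\<exists>T. c0_semigroup T \<and> is_generator_of D A T)"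

definition resolvent_set :: "'a :: complex_hilbert set \<Rightarrow> ('a \<Rightarrow> 'a) \<Rightarrow> complex set"
  where "resolvent_set D A = {s. \<exists>R. bounded_clinear R \<and>
    (\<forall>y. R y \<in> D \<and> s *\<^sub>C R y - A (R y) = y) \<and> (\<forall>x\<in>D. R (s *\<^sub>C x - A x) = x)}"

definition spectrum :: "'a :: complex_hilbert set \<Rightarrow> ('a \<Rightarrow> 'a) \<Rightarrow> complex set"
  where "spectrum D A = - resolvent_set D A"

definition eigenvalues :: "'a :: complex_hilbert set \<Rightarrow> ('a \<Rightarrow> 'a) \<Rightarrow> complex set"
  where "eigenvalues D A = {\<mu>. \<exists>x\<in>D. x \<noteq> 0 \<and> A x = \<mu> *\<^sub>C x}"

text \<open>The kernel of the \<open>m\<close>-th power of \<open>\<mu> - A\<close>, with the natural domain of that power.\<close>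

primrec kernel_power ::
    "'a :: complex_hilbert set \<Rightarrow> ('a \<Rightarrow> 'a) \<Rightarrow> complex \<Rightarrow> nat \<Rightarrow> 'a set"
  where
    "kernel_power D A \<mu> 0 = {0}"
  | "kernel_power D A \<mu> (Suc m) = {x \<in> D. \<mu> *\<^sub>C x - A x \<in> kernel_power D A \<mu> m}"

definition generalized_eigenspace ::
    "'a :: complex_hilbert set \<Rightarrow> ('a \<Rightarrow> 'a) \<Rightarrow> complex \<Rightarrow> 'a set"
  where "generalized_eigenspace D A \<mu> = (\<Union>m. kernel_power D A \<mu> m)"

text \<open>Beware that \<open>complex_vector.dim\<close> is \<open>0\<close> on infinite-dimensional spaces, so this is meaningful only
  together with \<open>finite_dimensional (generalized_eigenspace D A \<mu>)\<close>.\<close>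

definition algebraic_multiplicity ::
    "'a :: complex_hilbert set \<Rightarrow> ('a \<Rightarrow> 'a) \<Rightarrow> complex \<Rightarrow> nat"
  where "algebraic_multiplicity D A \<mu> = complex_vector.dim (generalized_eigenspace D A \<mu>)"

definition discrete_spectrum :: "'a :: complex_hilbert set \<Rightarrow> ('a \<Rightarrow> 'a) \<Rightarrow> bool"
  where "discrete_spectrum D A \<longleftrightarrow> spectrum D A \<noteq> {} \<and>
    (\<forall>\<mu>\<in>spectrum D A. \<mu> isolated_in spectrum D A \<and> \<mu> \<in> eigenvalues D A \<and>
      finite_dimensional (generalized_eigenspace D A \<mu>))"

text \<open>\<open>y\<close> is in the domain of the adjoint, with value \<open>w\<close>. For dense \<open>D\<close> the value is unique.\<close>

definition adjoint_value :: "'a :: complex_hilbert set \<Rightarrow> ('a \<Rightarrow> 'a) \<Rightarrow> 'a \<Rightarrow> 'a \<Rightarrow> bool"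
  where "adjoint_value D A y w \<longleftrightarrow> (\<forall>x\<in>D. cinner (A x) y = cinner x w)"

definition adjoint_domain :: "'a :: complex_hilbert set \<Rightarrow> ('a \<Rightarrow> 'a) \<Rightarrow> 'a set"
  where "adjoint_domain D A = {y. \<exists>w. adjoint_value D A y w}"

definition self_adjoint :: "'a :: complex_hilbert set \<Rightarrow> ('a \<Rightarrow> 'a) \<Rightarrow> bool"
  where "self_adjoint D A \<longleftrightarrow> linear_operator D A \<and> closure D = UNIV \<and>
    adjoint_domain D A = D \<and> (\<forall>y\<in>D. adjoint_value D A y (A y))"


section \<open>Single-input single-output systems\<close>

text \<open>A system is given by its generator \<open>D\<close>, \<open>A\<close> and the vectors \<open>b\<close>, \<open>c\<close> that represent the
  operators \<open>B\<close> and \<open>C\<close>.\<close>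

definition input_op :: "'a :: complex_hilbert \<Rightarrow> complex \<Rightarrow> 'a"
  where "input_op b u = u *\<^sub>C b"

definition output_op :: "'a :: complex_hilbert \<Rightarrow> 'a \<Rightarrow> complex"
  where "output_op c x = cinner x c"

definition siso_system ::
    "'a :: complex_hilbert set \<Rightarrow> ('a \<Rightarrow> 'a) \<Rightarrow> 'a \<Rightarrow> 'a \<Rightarrow> bool"
  where "siso_system D A b c \<longleftrightarrow>
    linear_operator D A \<and> generates_c0_semigroup D A \<and> discrete_spectrum D A \<and> b \<noteq> 0 \<and> c \<noteq> 0"

definition collocated_self_adjoint ::
    "'a :: complex_hilbert set \<Rightarrow> ('a \<Rightarrow> 'a) \<Rightarrow> 'a \<Rightarrow> 'a \<Rightarrow> bool"
  where "collocated_self_adjoint D A b c \<longleftrightarrow> self_adjoint D A \<and>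
    (\<forall>u x. cinner (input_op b u) x = cinner u (output_op c x))"

definition invariant_zeros ::
    "'a :: complex_hilbert set \<Rightarrow> ('a \<Rightarrow> 'a) \<Rightarrow> 'a \<Rightarrow> 'a \<Rightarrow> complex set"
  where "invariant_zeros D A b c =
    {\<mu>. \<exists>x\<in>D. \<exists>u. x \<noteq> 0 \<and> (\<mu> *\<^sub>C x - A x) - input_op b u = 0 \<and> output_op c x = 0}"

definition minimal_system ::
    "'a :: complex_hilbert set \<Rightarrow> ('a \<Rightarrow> 'a) \<Rightarrow> 'a \<Rightarrow> 'a \<Rightarrow> bool"
  where "minimal_system D A b c \<longleftrightarrow> invariant_zeros D A b c \<inter> spectrum D A = {}"

definition resolvent ::
    "'a :: complex_hilbert set \<Rightarrow> ('a \<Rightarrow> 'a) \<Rightarrow> complex \<Rightarrow> 'a \<Rightarrow> 'a"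
  where "resolvent D A s = inv_into D (\<lambda>x. s *\<^sub>C x - A x)"

definition transfer_function ::
    "'a :: complex_hilbert set \<Rightarrow> ('a \<Rightarrow> 'a) \<Rightarrow> 'a \<Rightarrow> 'a \<Rightarrow> complex \<Rightarrow> complex"
  where "transfer_function D A b c s = output_op c (resolvent D A s (input_op b 1))"

definition transmission_zeros ::
    "'a :: complex_hilbert set \<Rightarrow> ('a \<Rightarrow> 'a) \<Rightarrow> 'a \<Rightarrow> 'a \<Rightarrow> complex set"
  where "transmission_zeros D A b c =
    {s \<in> resolvent_set D A. transfer_function D A b c s = 0}"

text \<open>So for minimal systems one can speak of ``the zeros'' without specifying the kind.\<close>

lemma invariant_zeros_eq_transmission_zeros:
  assumes sys: "siso_system D A b c" and min: "minimal_system D A b c"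
  shows "invariant_zeros D A b c = transmission_zeros D A b c"
proof -
  have res: "resolvent D A s (s *\<^sub>C x - A x) = x" if "s \<in> resolvent_set D A" "x \<in> D" for s x
  proof -
    from that(1) obtain R where "\<forall>x\<in>D. R (s *\<^sub>C x - A x) = x"
      by (auto simp: resolvent_set_def)
    hence "inj_on (\<lambda>x. s *\<^sub>C x - A x) D"
      by (auto intro: inj_on_inverseI[where g = R])
    thus ?thesis
      unfolding resolvent_def using that(2) by (rule inv_into_f_f)
  qed
  have lin: "s *\<^sub>C (a *\<^sub>C x) - A (a *\<^sub>C x) = a *\<^sub>C (s *\<^sub>C x - A x)" "a *\<^sub>C x \<in> D" if "x \<in> D" for s a x
  proof -
    have "A (a *\<^sub>C x) = a *\<^sub>C A x" and "complex_vector.subspace D"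
      using sys that by (simp_all add: siso_system_def linear_operator_def)
    thus "s *\<^sub>C (a *\<^sub>C x) - A (a *\<^sub>C x) = a *\<^sub>C (s *\<^sub>C x - A x)" "a *\<^sub>C x \<in> D"
      using that by (simp_all add: complex_vector.subspace_scale
          complex_vector.scale_right_diff_distrib scaleC_scaleC mult.commute)
  qed
  show ?thesis
  proof (intro set_eqI iffI)
    fix s assume s: "s \<in> invariant_zeros D A b c"
    hence rho: "s \<in> resolvent_set D A"
      using min by (auto simp: minimal_system_def spectrum_def)
    from s obtain x u where x: "x \<in> D" "x \<noteq> 0" "s *\<^sub>C x - A x = u *\<^sub>C b" "cinner x c = 0"
      by (auto simp: invariant_zeros_def input_op_def output_op_def)
    have "u \<noteq> 0"
    proof
      assume "u = 0"
      hence "s *\<^sub>C x - A x = 0"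
        using x(3) by simp
      moreover have "s *\<^sub>C (0 *\<^sub>C x) - A (0 *\<^sub>C x) = 0"
        unfolding lin(1)[OF x(1)] by simp
      ultimately have "x = 0 *\<^sub>C x"
        using res[OF rho x(1)] res[OF rho lin(2)[OF x(1)], of 0] by argo
      thus False using x(2) by simp
    qed
    hence "s *\<^sub>C (inverse u *\<^sub>C x) - A (inverse u *\<^sub>C x) = b"
      unfolding lin(1)[OF x(1)] x(3) by (simp add: scaleC_scaleC scaleC_one)
    hence "resolvent D A s b = inverse u *\<^sub>C x"
      using res[OF rho lin(2)[OF x(1), of "inverse u"]] by argo
    thus "s \<in> transmission_zeros D A b c"
      using rho x(4) by (simp add: transmission_zeros_def transfer_function_def
          input_op_def output_op_def cinner_scaleC_left)
  next
    fix s assume s: "s \<in> transmission_zeros D A b c"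
    hence rho: "s \<in> resolvent_set D A" by (simp add: transmission_zeros_def)
    then obtain x where x: "x \<in> D" "s *\<^sub>C x - A x = b"
      by (auto simp: resolvent_set_def)
    have "resolvent D A s b = x" using res[OF rho x(1)] x(2) by simp
    hence "cinner x c = 0"
      using s by (simp add: transmission_zeros_def transfer_function_def input_op_def output_op_def)
    moreover have "x \<noteq> 0"
    proof
      assume "x = 0"
      hence "s *\<^sub>C x - A x = 0"
        using lin(1)[OF x(1), of s 0] by simp
      thus False using x(2) sys by (simp add: siso_system_def)
    qed
    moreover have "s *\<^sub>C x - A x - input_op b 1 = 0"
      using x(2) by (simp add: input_op_def scaleC_one)
    ultimately show "s \<in> invariant_zeros D A b c"
      unfolding invariant_zeros_def output_op_def using x(1) by blast
  qed
qed

text \<open>The operator \<open>A - k B C\<close>, with domain \<open>D\<close>.\<close>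

definition closed_loop ::
    "('a :: complex_hilbert \<Rightarrow> 'a) \<Rightarrow> 'a \<Rightarrow> 'a \<Rightarrow> real \<Rightarrow> 'a \<Rightarrow> 'a"
  where "closed_loop A b c k x = A x - complex_of_real k *\<^sub>C input_op b (output_op c x)"

text \<open>The family \<open>l\<close>, indexed by \<open>I\<close>, lists the eigenvalues counted with algebraic multiplicity.
  For \<open>\<mu>\<close> that is not an eigenvalue the generalized eigenspace is zero, so \<open>\<mu>\<close> is not listed.\<close>

definition lists_eigenvalues ::
    "'a :: complex_hilbert set \<Rightarrow> ('a \<Rightarrow> 'a) \<Rightarrow> nat set \<Rightarrow> (nat \<Rightarrow> complex) \<Rightarrow> bool"
  where "lists_eigenvalues D A I l \<longleftrightarrow>
    (\<forall>\<mu>. finite_dimensional (generalized_eigenspace D A \<mu>) \<and> finite {n\<in>I. l n = \<mu>} \<and>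
      card {n\<in>I. l n = \<mu>} = algebraic_multiplicity D A \<mu>)"

text \<open>The index set is a set of naturals, since the number of branches may be finite or infinite.
  For \<open>k = 0\<close> the second condition says that the starting points \<open>f n 0\<close> are the eigenvalues of \<open>A\<close>.\<close>

definition root_locus ::
    "'a :: complex_hilbert set \<Rightarrow> ('a \<Rightarrow> 'a) \<Rightarrow> 'a \<Rightarrow> 'a \<Rightarrow> nat set \<Rightarrow> (nat \<Rightarrow> real \<Rightarrow> complex) \<Rightarrow> bool"
  where "root_locus D A b c I f \<longleftrightarrow>
    (\<forall>n\<in>I. continuous_on {0..} (f n)) \<and>
    (\<forall>k\<ge>0. lists_eigenvalues D (closed_loop A b c k) I (\<lambda>n. f n k))"

text \<open>Two sets of points alternate along the real line.\<close>

definition interlace :: "complex set \<Rightarrow> complex set \<Rightarrow> bool"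
  where "interlace S S' \<longleftrightarrow> S \<subseteq> \<real> \<and> S' \<subseteq> \<real> \<and> S \<inter> S' = {} \<and>
    (\<forall>p\<in>S. \<forall>q\<in>S. Re p < Re q \<longrightarrow> (\<exists>r\<in>S'. Re p < Re r \<and> Re r < Re q)) \<and>
    (\<forall>p\<in>S'. \<forall>q\<in>S'. Re p < Re q \<longrightarrow> (\<exists>r\<in>S. Re p < Re r \<and> Re r < Re q))"

text \<open>The curve moves strictly to the left on all of \<open>[0,\<infinity>)\<close> and tends to \<open>z\<close>, so \<open>z\<close> lies strictly to
  the left of its starting point.\<close>

definition converges_left :: "(real \<Rightarrow> complex) \<Rightarrow> complex \<Rightarrow> bool"
  where "converges_left g z \<longleftrightarrow>
    (\<forall>j k. 0 \<le> j \<and> j < k \<longrightarrow> Re (g k) < Re (g j)) \<and> (g \<longlongrightarrow> z) at_top"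

end

theory Submission
  imports Defs "HOL-Computational_Algebra.Fundamental_Theorem_Algebra"
begin

text \<open>
  Minimality makes all eigenvalues of \<open>A\<close> simple, with eigenvectors not orthogonal to \<open>b\<close>. On the
  real part of the resolvent set the transfer function \<open>G\<close> is real with \<open>G' t = - \<parallel>R t b\<parallel>\<^sup>2 < 0\<close>. At an
  eigenvalue \<open>l\<close> the derivative is at most \<open>- r / (t - l)\<^sup>2\<close> for some \<open>r > 0\<close>, so \<open>G\<close> jumps there from
  \<open>-\<infinity>\<close> to \<open>\<infinity>\<close>, and zeros and eigenvalues interlace. For \<open>k > 0\<close> the eigenvalues of \<open>A - k B B\<^sup>*\<close> are
  the solutions of \<open>G t = - 1 / k\<close>. A branch therefore never meets the spectrum of \<open>A\<close> for \<open>k > 0\<close>, it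
  decreases with \<open>k\<close>, and it converges to a zero as soon as there is an eigenvalue further to the left.
  Such an eigenvalue exists in infinite dimensions: the semigroup bounds the spectrum from above, and
  if the spectrum were finite, then a polynomial in a resolvent operator would vanish and the
  eigenvectors would span the space.
\<close>


section \<open>The inner product\<close>

lemma cinner_add_right: "cinner x (y + z) = cinner x y + cinner x (z :: 'a :: complex_hilbert)"
  by (metis cinner_add_left cinner_commute complex_cnj_add)

lemma cinner_scaleC_right: "cinner x (a *\<^sub>C y) = cnj a * cinner x (y :: 'a :: complex_hilbert)"
  by (metis cinner_commute cinner_scaleC_left complex_cnj_mult)

lemma norm_scaleC [simp]: "norm (a *\<^sub>C x) = cmod a * norm (x :: 'a :: complex_hilbert)"
proof -
  have "complex_of_real ((norm (a *\<^sub>C x))\<^sup>2) = complex_of_real ((cmod a * norm x)\<^sup>2)"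
    unfolding cinner_self [symmetric] cinner_scaleC_left cinner_scaleC_right
    by (simp add: cinner_self power_mult_distrib complex_norm_square [symmetric] mult.commute)
  then have "(norm (a *\<^sub>C x))\<^sup>2 = (cmod a * norm x)\<^sup>2"
    using of_real_eq_iff by blast
  then show ?thesis
    by (simp add: power2_eq_iff_nonneg)
qed

lemma cauchy_schwarz: "cmod (cinner x y) \<le> norm x * norm (y :: 'a :: complex_hilbert)"
proof (cases "y = 0")
  case True
  have "cinner x y = 0"
    using cinner_scaleC_right [of x 0 y] True by simp
  then show ?thesis by simp
next
  case False
  \<comment> \<open>Up to the factor \<open>n\<close>, the vector
    \<open>n *\<^sub>C x + (- a) *\<^sub>C y\<close> is the component of \<open>x\<close> orthogonal
    to \<open>y\<close>. Expanding its squared norm gives the inequality.\<close>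
  define a n where "a = cinner x y" and "n = complex_of_real ((norm y)\<^sup>2)"
  have yx: "cinner y x = cnj a"
    by (simp add: a_def cinner_commute [of y x])
  have n: "n = cinner y y"
    by (simp add: n_def cinner_self)
  have "complex_of_real ((norm (n *\<^sub>C x + (- a) *\<^sub>C y))\<^sup>2) =
      n * cnj n * complex_of_real ((norm x)\<^sup>2) - n * (a * cnj a)"
    unfolding cinner_self [symmetric]
    by (simp only: cinner_add_left cinner_add_right cinner_scaleC_left cinner_scaleC_right yx n [symmetric]
        a_def [symmetric]) (simp add: n_def algebra_simps)
  also have "\<dots> = complex_of_real ((norm y)\<^sup>2 * ((norm y)\<^sup>2 * (norm x)\<^sup>2 - (cmod a)\<^sup>2))"
    by (simp add: n_def complex_norm_square [symmetric] algebra_simps)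
  finally have "(norm (n *\<^sub>C x + (- a) *\<^sub>C y))\<^sup>2 = (norm y)\<^sup>2 * ((norm y)\<^sup>2 * (norm x)\<^sup>2 - (cmod a)\<^sup>2)"
    using of_real_eq_iff by blast
  then have "0 \<le> (norm y)\<^sup>2 * ((norm y)\<^sup>2 * (norm x)\<^sup>2 - (cmod a)\<^sup>2)"
    by (metis zero_le_power2)
  then have "(cmod a)\<^sup>2 \<le> (norm x * norm y)\<^sup>2"
    using False by (simp add: zero_le_mult_iff power_mult_distrib mult.commute)
  then show ?thesis
    unfolding a_def by (rule power2_le_imp_le) simp
qed

text \<open>Bilinearity is over the reals, since the product is conjugate linear in its second
  argument. This supplies the difference, zero and limit rules.\<close>

global_interpretation cinner: bounded_bilinear "cinner :: 'a :: complex_hilbert \<Rightarrow> 'a \<Rightarrow> complex"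
proof
  show "\<exists>K. \<forall>x y :: 'a. norm (cinner x y) \<le> norm x * norm y * K"
    by (rule exI [of _ 1]) (simp add: cauchy_schwarz)
qed (simp_all add: cinner_add_left cinner_add_right scaleR_eq_scaleC scaleC_complex_def
    cinner_scaleC_left cinner_scaleC_right)

lemma cinner_eq_self_iff: "cinner x x = 0 \<longleftrightarrow> (x :: 'a :: complex_hilbert) = 0"
  by (simp add: cinner_self)

lemma norm_diff_square:
  "(norm (x - y))\<^sup>2 = (norm x)\<^sup>2 - 2 * Re (cinner x y) + (norm (y :: 'a :: complex_hilbert))\<^sup>2"
proof -
  have "complex_of_real ((norm (x - y))\<^sup>2) = cinner x x - (cinner x y + cnj (cinner x y)) + cinner y y"
    unfolding cinner_self [symmetric]
    by (simp add: cinner.diff_left cinner.diff_right cinner_commute [of y x])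
  also have "\<dots> = complex_of_real ((norm x)\<^sup>2 - 2 * Re (cinner x y) + (norm y)\<^sup>2)"
    by (simp add: cinner_self complex_add_cnj)
  finally show ?thesis
    using of_real_eq_iff by blast
qed


section \<open>Polynomials in a bounded operator\<close>

lemma bounded_clinear_add: "bounded_clinear S \<Longrightarrow> S (x + y) = S x + S y"
  and bounded_clinear_diff: "bounded_clinear S \<Longrightarrow> S (x - y) = S x - S y"
  and bounded_clinear_scaleC: "bounded_clinear S \<Longrightarrow> S (a *\<^sub>C x) = a *\<^sub>C S x"
  and bounded_clinear_zero: "bounded_clinear S \<Longrightarrow> S 0 = 0"
  by (auto simp: bounded_clinear_def linear_simps)

text \<open>Evaluation of \<open>p\<close> at the operator \<open>S\<close> by Horner's
  scheme.\<close>

definition poly_op :: "('a :: complex_hilbert \<Rightarrow> 'a) \<Rightarrow> complex poly \<Rightarrow> 'a \<Rightarrow> 'a"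
  where "poly_op S p = fold_coeffs (\<lambda>a F x. a *\<^sub>C x + S (F x)) p (\<lambda>x. 0)"

text \<open>The \<open>r\<close> for which \<open>S - r\<close> is not bounded below form the
  approximate point spectrum of \<open>S\<close>. It serves as the spectrum of bounded operators
  here, so that lower bounds are all that has to be tracked.\<close>

definition bounded_below :: "('a :: complex_hilbert \<Rightarrow> 'a) \<Rightarrow> bool"
  where "bounded_below F \<longleftrightarrow> (\<exists>c>0. \<forall>x. c * norm x \<le> norm (F x))"

definition symmetric_op :: "('a :: complex_hilbert \<Rightarrow> 'a) \<Rightarrow> bool"
  where "symmetric_op F \<longleftrightarrow> (\<forall>x y. cinner (F x) y = cinner x (F y))"

lemma bounded_below_comp:
  assumes "bounded_below F" "bounded_below H"
  shows "bounded_below (\<lambda>x. F (H x))"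
proof -
  obtain c d where c: "c > 0" "\<And>x. c * norm x \<le> norm (F x)"
    and d: "d > 0" "\<And>x. d * norm x \<le> norm (H x)"
    using assms by (auto simp: bounded_below_def)
  have "c * d * norm x \<le> norm (F (H x))" for x
  proof -
    have "c * (d * norm x) \<le> c * norm (H x)"
      using c(1) d(2) by simp
    also have "\<dots> \<le> norm (F (H x))"
      by (rule c(2))
    finally show ?thesis by (simp add: mult.assoc)
  qed
  then show ?thesis
    using c(1) d(1) by (auto simp: bounded_below_def intro!: exI [of _ "c * d"])
qed

context
  fixes S :: "'a :: complex_hilbert \<Rightarrow> 'a"
  assumes S: "bounded_clinear S"
begin

lemma poly_op_0 [simp]: "poly_op S 0 x = 0"
  by (simp add: poly_op_def)

lemma poly_op_pCons [simp]: "poly_op S (pCons a p) x = a *\<^sub>C x + S (poly_op S p x)"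
\<comment> \<open>\<open>fold_coeffs\<close> performs no step for the zero polynomial, so here the
  equation rests on \<open>S 0 = 0\<close>.\<close>
proof (cases "a = 0 \<and> p = 0")
  case True
  then show ?thesis by (simp add: bounded_clinear_zero [OF S])
next
  case False
  then show ?thesis by (auto simp: poly_op_def)
qed

lemma poly_op_add: "poly_op S (p + q) x = poly_op S p x + poly_op S q x"
  by (induction p q rule: poly_induct2)
    (simp_all add: bounded_clinear_add [OF S] scaleC_add_left algebra_simps)

lemma poly_op_smult: "poly_op S (smult a p) x = a *\<^sub>C poly_op S p x"
  by (induction p) (simp_all add: bounded_clinear_scaleC [OF S] scaleC_add_right scaleC_scaleC)

lemma poly_op_mult: "poly_op S (p * q) x = poly_op S p (poly_op S q x)"
  by (induction p) (simp_all add: poly_op_add poly_op_smult)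

lemma poly_op_linear: "poly_op S [:- r, 1:] x = S x - r *\<^sub>C x"
  by (simp add: bounded_clinear_zero [OF S] scaleC_one)

lemma poly_op_commute: "S (poly_op S p x) = poly_op S p (S x)"
proof -
  \<comment> \<open>\<open>S\<close> is the value of the polynomial X, so commutativity of the
    polynomial ring applies.\<close>
  have "S z = poly_op S [:- 0, 1:] z" for z
    unfolding poly_op_linear by simp
  then show ?thesis
    by (metis poly_op_mult mult.commute)
qed

lemma bounded_clinear_poly_op: "bounded_clinear (poly_op S p)"
proof (induction p)
  case 0
  have "poly_op S 0 = (\<lambda>x. 0)" by (rule ext) simp
  then show ?case by (simp add: bounded_clinear_def)
next
  case (pCons a p)
  have "bounded_linear (\<lambda>x :: 'a. a *\<^sub>C x)"
    by (rule bounded_linear_intro [where K = "cmod a"])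
      (simp_all add: scaleC_add_right scaleR_eq_scaleC scaleC_scaleC mult.commute)
  then have "bounded_linear (\<lambda>x. a *\<^sub>C x + S (poly_op S p x))"
    using S pCons.IH unfolding bounded_clinear_def
    by (intro bounded_linear_add) (auto intro: bounded_linear_compose)
  moreover have "poly_op S (pCons a p) = (\<lambda>x. a *\<^sub>C x + S (poly_op S p x))"
    by (rule ext) simp
  moreover have "poly_op S p (t *\<^sub>C x) = t *\<^sub>C poly_op S p x" for t x
    using pCons.IH by (rule bounded_clinear_scaleC)
  ultimately show ?case
    by (simp add: bounded_clinear_def bounded_clinear_scaleC [OF S] scaleC_add_right scaleC_scaleC
        mult.commute)
qed

text \<open>Moving \<open>S\<close> and \<open>poly_op S p\<close> across the inner product reverses
  their order, which \<open>poly_op_commute\<close> repairs.\<close>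

lemma symmetric_poly_op:
  assumes "symmetric_op S" and "\<And>i. coeff p i \<in> \<real>"
  shows "symmetric_op (poly_op S p)"
  using assms(2)
proof (induction p)
  case 0
  then show ?case by (simp add: symmetric_op_def cinner.zero_left cinner.zero_right)
next
  case (pCons a p)
  have "cnj a = a"
    using pCons.prems [of 0] by (simp add: Reals_cnj_iff)
  moreover have "symmetric_op (poly_op S p)"
  proof (rule pCons.IH)
    show "coeff p i \<in> \<real>" for i
      using pCons.prems [of "Suc i"] by simp
  qed
  ultimately show ?case
    using assms(1)
    by (simp add: symmetric_op_def cinner_add_left cinner_add_right cinner_scaleC_left
        cinner_scaleC_right poly_op_commute)
qed

text \<open>One half of the spectral mapping theorem: over the complex numbers \<open>p\<close>
  splits into linear factors, each factor is bounded below by assumption, and lower bounds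
  compose.\<close>

lemma bounded_below_poly_op:
  assumes "p \<noteq> 0" and "\<And>r. poly p r = 0 \<Longrightarrow> bounded_below (\<lambda>x. S x - r *\<^sub>C x)"
  shows "bounded_below (poly_op S p)"
  using assms
proof (induction "degree p" arbitrary: p)
  case 0
  then obtain a where a: "p = [:a:]"
    by (metis degree_eq_zeroE)
  have "bounded_below (\<lambda>x :: 'a. a *\<^sub>C x)"
    using 0(2) a by (auto simp: bounded_below_def intro!: exI [of _ "cmod a"])
  moreover have "poly_op S p = (\<lambda>x. a *\<^sub>C x)"
    by (rule ext) (simp add: a bounded_clinear_zero [OF S])
  ultimately show ?case by simp
next
  case (Suc n)
  have "\<not> constant (poly p)"
    using Suc.hyps(2) by (simp add: constant_degree)
  then obtain r where r: "poly p r = 0"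
    using fundamental_theorem_of_algebra by blast
  then obtain q where q: "p = [:- r, 1:] * q"
    by (auto simp: poly_eq_0_iff_dvd)
  then have "q \<noteq> 0"
    using Suc.prems(1) by auto
  then have "degree p = Suc (degree q)"
    unfolding q by (subst degree_mult_eq) auto
  then have "bounded_below (poly_op S q)"
    using Suc q \<open>q \<noteq> 0\<close> by auto
  then have "bounded_below (\<lambda>x. S (poly_op S q x) - r *\<^sub>C poly_op S q x)"
    using bounded_below_comp [OF Suc.prems(2) [OF r]] by simp
  moreover have "poly_op S p = (\<lambda>x. S (poly_op S q x) - r *\<^sub>C poly_op S q x)"
    unfolding q poly_op_mult poly_op_linear by (rule ext) simp
  ultimately show ?case by simp
qed

end

text \<open>Along unit vectors with \<open>\<parallel>T x\<parallel>\<close> close to the norm \<open>N\<close> of \<open>T\<close>, the vectors \<open>T (T x) - N\<^sup>2 x\<close> tend to \<open>0\<close>.\<close>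

lemma symmetric_op_not_bounded_below:
  fixes T :: "'a :: complex_hilbert \<Rightarrow> 'a"
  assumes T: "bounded_clinear T" and sym: "symmetric_op T" and "T z \<noteq> 0"
  obtains N where "N > 0" "\<not> bounded_below (\<lambda>x. T (T x) - complex_of_real (N\<^sup>2) *\<^sub>C x)"
proof
  have bl: "bounded_linear T"
    using T by (simp add: bounded_clinear_def)
  define N where "N = onorm T"
  have le: "norm (T x) \<le> N * norm x" for x
    unfolding N_def by (rule onorm [OF bl])
  show N: "N > 0"
    unfolding N_def using onorm_pos_lt [OF bl] \<open>T z \<noteq> 0\<close> by auto
  show "\<not> bounded_below (\<lambda>x. T (T x) - complex_of_real (N\<^sup>2) *\<^sub>C x)"
  proof
    assume "bounded_below (\<lambda>x. T (T x) - complex_of_real (N\<^sup>2) *\<^sub>C x)"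
    then obtain c where c: "c > 0"
      "\<And>x. c * norm x \<le> norm (T (T x) - complex_of_real (N\<^sup>2) *\<^sub>C x)"
      by (auto simp: bounded_below_def)
    \<comment> \<open>Expanding the square of the assumed lower bound, with \<open>N\<close>
      bounding the outer \<open>T\<close>, yields this \<open>M\<close>. It is smaller than the
      square of \<open>N\<close>, although \<open>N\<close> is the least bound for
      \<open>T\<close>.\<close>
    define M where "M = N\<^sup>2 - c\<^sup>2 / N\<^sup>2"
    have M: "(norm (T x))\<^sup>2 \<le> M * (norm x)\<^sup>2" for x
    proof -
      have "cinner (T (T x)) x = cinner (T x) (T x)"
        using sym by (simp add: symmetric_op_def)
      then have inn: "Re (cinner (T (T x)) (complex_of_real (N\<^sup>2) *\<^sub>C x)) = N\<^sup>2 * (norm (T x))\<^sup>2"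
        by (simp add: cinner_scaleC_right cinner_self flip: of_real_power of_real_mult)
      have "(c * norm x)\<^sup>2 \<le> (norm (T (T x) - complex_of_real (N\<^sup>2) *\<^sub>C x))\<^sup>2"
        using c by (intro power_mono) auto
      also have "\<dots> = (norm (T (T x)))\<^sup>2 - 2 * N\<^sup>2 * (norm (T x))\<^sup>2 + N ^ 4 * (norm x)\<^sup>2"
        unfolding norm_diff_square inn by (simp add: power_mult_distrib norm_power)
      also have "(norm (T (T x)))\<^sup>2 \<le> (N * norm (T x))\<^sup>2"
        using le by (intro power_mono) auto
      finally have "c\<^sup>2 * (norm x)\<^sup>2 \<le> N\<^sup>2 * (N\<^sup>2 * (norm x)\<^sup>2 - (norm (T x))\<^sup>2)"
        by (simp add: power_mult_distrib algebra_simps flip: power_add)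
      then have "c\<^sup>2 * (norm x)\<^sup>2 / N\<^sup>2 \<le> N\<^sup>2 * (norm x)\<^sup>2 - (norm (T x))\<^sup>2"
        using N by (simp add: divide_le_eq mult.commute)
      then show ?thesis
        by (simp add: M_def algebra_simps)
    qed
    have "0 < (norm (T z))\<^sup>2"
      using \<open>T z \<noteq> 0\<close> by simp
    then have "0 < M * (norm z)\<^sup>2"
      using M [of z] by linarith
    then have "0 < M"
      by (simp add: zero_less_mult_iff)
    have "norm (T x) \<le> sqrt M * norm x" for x
      using M [of x] real_le_rsqrt by (fastforce simp: real_sqrt_mult)
    then have "N \<le> sqrt M"
      unfolding N_def using \<open>0 < M\<close> by (intro onorm_bound) auto
    then have "N\<^sup>2 \<le> M"
      using N \<open>0 < M\<close> by (metis less_imp_le power_mono real_sqrt_pow2)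
    then show False
      using N c(1) by (simp add: M_def divide_le_0_iff)
  qed
qed

text \<open>Let \<open>q\<close> be the product and \<open>T\<close> its value at \<open>S\<close>.
  If \<open>T\<close> is nonzero, then the square of \<open>T\<close> minus some
  \<open>N\<^sup>2\<close> is not bounded below. But it is the value at \<open>S\<close> of
  \<open>p = q\<^sup>2 - N\<^sup>2\<close>, which equals \<open>- N\<^sup>2\<close> on
  \<open>K\<close>, so all roots of \<open>p\<close> lie outside \<open>K\<close> and
  \<open>bounded_below_poly_op\<close> contradicts this.\<close>

lemma poly_op_spectrum_eq_0:
  assumes S: "bounded_clinear S" and sym: "symmetric_op S"
    and K: "finite K" "K \<noteq> {}" "K \<subseteq> \<real>" "\<And>r. r \<notin> K \<Longrightarrow> bounded_below (\<lambda>x. S x - r *\<^sub>C x)"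
  shows "poly_op S (\<Prod>\<kappa>\<in>K. [:- \<kappa>, 1:]) x = 0"
proof (rule ccontr)
  define q where "q = (\<Prod>\<kappa>\<in>K. [:- \<kappa>, 1:])"
  assume "poly_op S (\<Prod>\<kappa>\<in>K. [:- \<kappa>, 1:]) x \<noteq> 0"
  then have nz: "poly_op S q x \<noteq> 0"
    by (simp add: q_def)
  have "\<forall>i. coeff q i \<in> \<real>"
    unfolding q_def using K(1,3)
  proof (induction K rule: finite_induct)
    case empty
    then show ?case by (simp add: coeff_1)
  next
    case (insert \<kappa> K)
    then show ?case
      by (auto simp: coeff_pCons split: nat.splits)
  qed
  then have symq: "symmetric_op (poly_op S q)"
    using symmetric_poly_op [OF S sym] by blast
  obtain N where N: "N > 0"
    "\<not> bounded_below (\<lambda>x. poly_op S q (poly_op S q x) - complex_of_real (N\<^sup>2) *\<^sub>C x)"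
    using symmetric_op_not_bounded_below [OF bounded_clinear_poly_op [OF S] symq nz] by metis
  define p where "p = q * q + [:- complex_of_real (N\<^sup>2):]"
  have p: "poly p r = (poly q r)\<^sup>2 - complex_of_real (N\<^sup>2)" for r
    by (simp add: p_def power2_eq_square)
  have "poly q r = 0" if "r \<in> K" for r
    using that K(1) by (auto simp: q_def poly_prod)
  then have out: "poly p r \<noteq> 0" if "r \<in> K" for r
    using that N(1) by (simp add: p)
  \<comment> \<open>A point of \<open>K\<close> is essential: for empty \<open>K\<close>,
    \<open>q\<close> is 1 and \<open>p\<close> vanishes when \<open>N\<close> is 1.\<close>
  have "p \<noteq> 0"
    using out K(2) by auto
  then have "bounded_below (poly_op S p)"
    using out K(4) by (intro bounded_below_poly_op [OF S]) auto
  moreover have "poly_op S p = (\<lambda>x. poly_op S q (poly_op S q x) - complex_of_real (N\<^sup>2) *\<^sub>C x)"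
    by (rule ext) (simp add: p_def poly_op_add [OF S] poly_op_mult [OF S] poly_op_pCons [OF S]
        poly_op_0 [OF S] bounded_clinear_zero [OF S])
  ultimately show False
    using N(2) by simp
qed


section \<open>The resolvent\<close>

locale linear_op =
  fixes D :: "'a :: complex_hilbert set" and A :: "'a \<Rightarrow> 'a"
  assumes linear: "linear_operator D A"
begin

lemma scale_in_D: "x \<in> D \<Longrightarrow> a *\<^sub>C x \<in> D"
  and add_in_D: "x \<in> D \<Longrightarrow> y \<in> D \<Longrightarrow> x + y \<in> D"
  and diff_in_D: "x \<in> D \<Longrightarrow> y \<in> D \<Longrightarrow> x - y \<in> D"
  using linear
  by (auto simp: linear_operator_def complex_vector.subspace_scale complex_vector.subspace_add
      complex_vector.subspace_diff)

lemma A_add: "x \<in> D \<Longrightarrow> y \<in> D \<Longrightarrow> A (x + y) = A x + A y"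
  and A_scale: "x \<in> D \<Longrightarrow> A (a *\<^sub>C x) = a *\<^sub>C A x"
  using linear by (auto simp: linear_operator_def)

lemma A_diff: "x \<in> D \<Longrightarrow> y \<in> D \<Longrightarrow> A (x - y) = A x - A y"
  using A_add [of x "(- 1) *\<^sub>C y"] A_scale [of y "- 1"] scale_in_D [of y "- 1"]
  by (simp add: scaleC_one)

lemma pencil_add:
  "x \<in> D \<Longrightarrow> y \<in> D \<Longrightarrow> s *\<^sub>C (x + y) - A (x + y) = (s *\<^sub>C x - A x) + (s *\<^sub>C y - A y)"
  by (simp add: A_add scaleC_add_right)

lemma pencil_diff:
  "x \<in> D \<Longrightarrow> y \<in> D \<Longrightarrow> s *\<^sub>C (x - y) - A (x - y) = (s *\<^sub>C x - A x) - (s *\<^sub>C y - A y)"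
  by (simp add: A_diff complex_vector.scale_right_diff_distrib)

lemma pencil_scale: "x \<in> D \<Longrightarrow> s *\<^sub>C (a *\<^sub>C x) - A (a *\<^sub>C x) = a *\<^sub>C (s *\<^sub>C x - A x)"
  by (simp add: A_scale complex_vector.scale_right_diff_distrib scaleC_scaleC mult.commute)

lemma pencil_shift: "s *\<^sub>C x - A x = (t *\<^sub>C x - A x) + (s - t) *\<^sub>C x"
  by (simp add: complex_vector.scale_left_diff_distrib)

text \<open>The lower bound makes solutions unique, hence the chosen inverse linear, and it bounds
  that inverse by \<open>1 / c\<close>.\<close>

lemma resolvent_setI:
  assumes surj: "\<And>y. \<exists>x\<in>D. s *\<^sub>C x - A x = y"
    and c: "c > 0" "\<And>x. x \<in> D \<Longrightarrow> c * norm x \<le> norm (s *\<^sub>C x - A x)"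
  shows "s \<in> resolvent_set D A"
proof -
  obtain R where R: "\<And>y. R y \<in> D" "\<And>y. s *\<^sub>C R y - A (R y) = y"
    using surj by metis
  have uniq: "R y = x" if "x \<in> D" "s *\<^sub>C x - A x = y" for x y
  proof -
    have "s *\<^sub>C (R y - x) - A (R y - x) = 0"
      using that R(1) R(2) [of y] by (simp add: pencil_diff)
    then have "c * norm (R y - x) \<le> 0"
      using c(2) [OF diff_in_D [OF R(1) that(1)], of y] by simp
    then show ?thesis
      using c(1) by (simp add: mult_le_0_iff)
  qed
  have scale: "R (a *\<^sub>C y) = a *\<^sub>C R y" for a y
    by (rule uniq) (simp_all only: R pencil_scale scale_in_D)
  have "bounded_linear R"
  proof (rule bounded_linear_intro [where K = "1 / c"])
    show "R (x + y) = R x + R y" for x y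
      by (rule uniq) (simp_all only: R pencil_add add_in_D)
    show "R (r *\<^sub>R x) = r *\<^sub>R R x" for r x
      by (simp add: scaleR_eq_scaleC scale)
    show "norm (R x) \<le> norm x * (1 / c)" for x
      using c(2) [OF R(1), of x] c(1) by (simp add: R pos_le_divide_eq mult.commute)
  qed
  then have "bounded_clinear R"
    by (simp add: bounded_clinear_def scale)
  then show ?thesis
    using R uniq by (auto simp: resolvent_set_def)
qed

abbreviation "R \<equiv> resolvent D A"

context
  fixes s assumes s: "s \<in> resolvent_set D A"
begin

text \<open>\<open>resolvent\<close> is an \<open>inv_into\<close>; injectivity of the pencil on
  \<open>D\<close> identifies it with the bounded inverse that witnesses membership in the resolvent
  set.\<close>

lemma
  shows bounded_clinear_R: "bounded_clinear (R s)"
    and R_in_D: "R s y \<in> D"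
    and pencil_R: "s *\<^sub>C R s y - A (R s y) = y"
    and R_pencil: "x \<in> D \<Longrightarrow> R s (s *\<^sub>C x - A x) = x"
proof -
  obtain Q where Q: "bounded_clinear Q" "\<And>y. Q y \<in> D" "\<And>y. s *\<^sub>C Q y - A (Q y) = y"
    "\<And>x. x \<in> D \<Longrightarrow> Q (s *\<^sub>C x - A x) = x"
    using s by (auto simp: resolvent_set_def)
  have "inj_on (\<lambda>x. s *\<^sub>C x - A x) D"
    using Q(4) by (auto intro: inj_on_inverseI [where g = Q])
  then have "R s y = Q y" for y
    using inv_into_f_f [of "\<lambda>x. s *\<^sub>C x - A x" D "Q y"] Q(2,3) by (simp add: resolvent_def)
  then have "R s = Q" by blast
  then show "bounded_clinear (R s)" "R s y \<in> D" "s *\<^sub>C R s y - A (R s y) = y"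
    "x \<in> D \<Longrightarrow> R s (s *\<^sub>C x - A x) = x"
    using Q by auto
qed

lemma R_eqI: "x \<in> D \<Longrightarrow> s *\<^sub>C x - A x = y \<Longrightarrow> R s y = x"
  using R_pencil by blast

lemma R_bound: obtains K where "K > 0" "\<And>y. norm (R s y) \<le> K * norm y"
  using bounded_linear.pos_bounded [of "R s"] bounded_clinear_R
  by (metis bounded_clinear_def mult.commute)

end

section \<open>Resolvent identity and perturbation of the spectral parameter\<close>

lemma resolvent_identity:
  assumes "s \<in> resolvent_set D A" "t \<in> resolvent_set D A"
  shows "R s y - R t y = (t - s) *\<^sub>C R s (R t y)"
proof -
  have "y = (s *\<^sub>C R t y - A (R t y)) + (t - s) *\<^sub>C R t y"
    using pencil_R [OF assms(2), of y] pencil_shift [of t "R t y" s] by simp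
  then have "R s y = R s ((s *\<^sub>C R t y - A (R t y)) + (t - s) *\<^sub>C R t y)"
    by simp
  also have "\<dots> = R t y + (t - s) *\<^sub>C R s (R t y)"
    using bounded_clinear_R [OF assms(1)] R_pencil [OF assms(1) R_in_D [OF assms(2)]]
    by (simp add: bounded_clinear_add bounded_clinear_scaleC)
  finally show ?thesis by simp
qed

text \<open>The equation \<open>s *\<^sub>C x - A x = y\<close> is equivalent to the fixed point
  equation \<open>x = R t (y + (t - s) *\<^sub>C x)\<close>, whose right side is a contraction with
  factor 1/2 by the choice of \<open>K\<close>. The same rewriting bounds \<open>norm x\<close> by a
  data term plus half of itself, whence the bound \<open>2 * K\<close>, uniform in
  \<open>s\<close>.\<close>

lemma resolvent_set_perturb:
  assumes t: "t \<in> resolvent_set D A"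
  obtains K where "K > 0"
    "\<And>s. cmod (s - t) * K \<le> 1 / 2 \<Longrightarrow> s \<in> resolvent_set D A"
    "\<And>s y. cmod (s - t) * K \<le> 1 / 2 \<Longrightarrow> norm (R s y) \<le> 2 * K * norm y"
proof -
  obtain K where K: "K > 0" "\<And>y. norm (R t y) \<le> K * norm y"
    using R_bound [OF t] by metis
  have below: "norm x \<le> 2 * K * norm (s *\<^sub>C x - A x)"
    if s: "cmod (s - t) * K \<le> 1 / 2" and x: "x \<in> D" for s x
  proof -
    have "norm x = norm (R t ((s *\<^sub>C x - A x) + (t - s) *\<^sub>C x))"
      using R_pencil [OF t x] pencil_shift [of t x s] by simp
    also have "\<dots> \<le> K * (norm (s *\<^sub>C x - A x) + cmod (s - t) * norm x)"
      using K norm_triangle_ineq [of "s *\<^sub>C x - A x" "(t - s) *\<^sub>C x"]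
      by (intro order_trans [OF K(2)]) (simp add: norm_minus_commute)
    also have "\<dots> = K * norm (s *\<^sub>C x - A x) + (cmod (s - t) * K) * norm x"
      by (simp add: algebra_simps)
    also have "\<dots> \<le> K * norm (s *\<^sub>C x - A x) + 1 / 2 * norm x"
      using s by (intro add_left_mono mult_right_mono) auto
    finally show ?thesis by simp
  qed
  have rho: "s \<in> resolvent_set D A" if s: "cmod (s - t) * K \<le> 1 / 2" for s
  proof (rule resolvent_setI)
    fix y
    define F where "F x = R t (y + (t - s) *\<^sub>C x)" for x
    have "dist (F x) (F x') \<le> 1 / 2 * dist x x'" for x x'
    proof -
      have "F x - F x' = R t ((t - s) *\<^sub>C (x - x'))"
        unfolding F_def bounded_clinear_diff [OF bounded_clinear_R [OF t], symmetric]
        by (simp add: complex_vector.scale_right_diff_distrib)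
      then have "dist (F x) (F x') \<le> K * (cmod (s - t) * dist x x')"
        using K(2) [of "(t - s) *\<^sub>C (x - x')"] by (simp add: dist_norm norm_minus_commute)
      also have "\<dots> = (cmod (s - t) * K) * dist x x'"
        by (simp add: algebra_simps)
      also have "\<dots> \<le> 1 / 2 * dist x x'"
        using s by (intro mult_right_mono) auto
      finally show ?thesis .
    qed
    then obtain x where x: "F x = x"
      using banach_fix_type [of "1 / 2" F] by auto
    have "x \<in> D"
      using x R_in_D [OF t] by (metis F_def)
    moreover have "t *\<^sub>C x - A x = y + (t - s) *\<^sub>C x"
      using x pencil_R [OF t, of "y + (t - s) *\<^sub>C x"] by (simp add: F_def)
    then have "s *\<^sub>C x - A x = y"
      using pencil_shift [of t x s] by simp
    ultimately show "\<exists>x\<in>D. s *\<^sub>C x - A x = y" by blast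
  next
    show "1 / (2 * K) > 0" using K(1) by simp
    show "1 / (2 * K) * norm x \<le> norm (s *\<^sub>C x - A x)" if "x \<in> D" for x
      using below [OF s that] K(1) by (simp add: field_simps)
  qed
  have "norm (R s y) \<le> 2 * K * norm y" if s: "cmod (s - t) * K \<le> 1 / 2" for s y
    using below [OF s R_in_D [OF rho [OF s]], of y] pencil_R [OF rho [OF s], of y] by simp
  with K(1) rho show thesis by (rule that)
qed

lemma resolvent_nbhd:
  assumes "t \<in> resolvent_set D A"
  obtains K where "K > 0" "\<forall>\<^sub>F s in nhds t. s \<in> resolvent_set D A \<and> (\<forall>y. norm (R s y) \<le> K * norm y)"
proof -
  obtain K where K: "K > 0"
    "\<And>s. cmod (s - t) * K \<le> 1 / 2 \<Longrightarrow> s \<in> resolvent_set D A"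
    "\<And>s y. cmod (s - t) * K \<le> 1 / 2 \<Longrightarrow> norm (R s y) \<le> 2 * K * norm y"
    using resolvent_set_perturb [OF assms] by metis
  have "\<forall>\<^sub>F s in nhds t. dist s t < 1 / (2 * K)"
    using K(1) by (intro eventually_nhds_metric [THEN iffD2] exI [of _ "1 / (2 * K)"]) auto
  then have "\<forall>\<^sub>F s in nhds t. cmod (s - t) * K \<le> 1 / 2"
    by eventually_elim (use K(1) in \<open>simp add: dist_norm field_simps\<close>)
  then have "\<forall>\<^sub>F s in nhds t. s \<in> resolvent_set D A \<and> (\<forall>y. norm (R s y) \<le> 2 * K * norm y)"
    by eventually_elim (use K in blast)
  with K(1) show thesis by (intro that [of "2 * K"]) auto
qed

lemma closed_spectrum: "closed (spectrum D A)"
proof -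
  have "open (resolvent_set D A)"
  proof (subst open_subopen, rule ballI)
    fix t assume "t \<in> resolvent_set D A"
    then obtain K where
      "\<forall>\<^sub>F s in nhds t. s \<in> resolvent_set D A \<and> (\<forall>y. norm (R s y) \<le> K * norm y)"
      by (rule resolvent_nbhd)
    then have "\<forall>\<^sub>F s in nhds t. s \<in> resolvent_set D A"
      by (rule eventually_mono) simp
    then show "\<exists>T. open T \<and> t \<in> T \<and> T \<subseteq> resolvent_set D A"
      by (auto simp: eventually_nhds)
  qed
  then show ?thesis
    by (simp add: spectrum_def closed_def)
qed

text \<open>The resolvent identity contributes the small factor \<open>t - s\<close>, and the local
  uniform bound of \<open>resolvent_nbhd\<close> controls the other factor.\<close>

lemma isCont_R:
  assumes t: "t \<in> resolvent_set D A"
  shows "isCont (\<lambda>s. R s y) t"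
proof -
  obtain K where K: "K > 0"
    "\<forall>\<^sub>F s in nhds t. s \<in> resolvent_set D A \<and> (\<forall>y. norm (R s y) \<le> K * norm y)"
    by (rule resolvent_nbhd [OF t])
  have "\<forall>\<^sub>F s in nhds t. norm (R s y - R t y) \<le> norm (t - s) * (K * norm (R t y))"
    using K(2)
  proof eventually_elim
    case (elim s)
    then have "norm (R s y - R t y) = cmod (t - s) * norm (R s (R t y))"
      using resolvent_identity [OF _ t] by simp
    also have "\<dots> \<le> cmod (t - s) * (K * norm (R t y))"
      using elim by (intro mult_left_mono) auto
    finally show ?case .
  qed
  then have "\<forall>\<^sub>F s in at t. norm (R s y - R t y) \<le> norm (t - s) * (K * norm (R t y))"
    by (simp add: eventually_nhds_conv_at)
  moreover have "((\<lambda>s. norm (t - s) * (K * norm (R t y))) \<longlongrightarrow> 0) (at t)"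
    by (auto intro!: tendsto_eq_intros)
  ultimately have "((\<lambda>s. R s y - R t y) \<longlongrightarrow> 0) (at t)"
    by (rule Lim_null_comparison)
  then show ?thesis
    unfolding isCont_def by (rule LIM_zero_cancel)
qed

lemma eigenvalues_subset_spectrum: "eigenvalues D A \<subseteq> spectrum D A"
proof
  fix \<mu> assume "\<mu> \<in> eigenvalues D A"
  then obtain x where x: "x \<in> D" "x \<noteq> 0" "\<mu> *\<^sub>C x - A x = 0"
    by (auto simp: eigenvalues_def)
  show "\<mu> \<in> spectrum D A"
  proof (rule ccontr)
    assume "\<mu> \<notin> spectrum D A"
    then have "\<mu> \<in> resolvent_set D A"
      by (simp add: spectrum_def)
    then show False
      using R_pencil x bounded_clinear_zero [OF bounded_clinear_R] by metis
  qed
qed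

end

text \<open>If \<open>l n\<close> were no eigenvalue, the pencil and all its powers would have zero
  kernel, the multiplicity would be 0 and no index could carry the value \<open>l n\<close>; but
  \<open>n\<close> does.\<close>

lemma eigenvalues_listed:
  assumes "lists_eigenvalues D F I l" "n \<in> I"
  shows "l n \<in> eigenvalues D F"
proof (rule ccontr)
  assume no: "l n \<notin> eigenvalues D F"
  have "kernel_power D F (l n) m \<subseteq> {0}" for m
  proof (induction m)
    case (Suc m)
    show ?case
    proof
      fix x assume "x \<in> kernel_power D F (l n) (Suc m)"
      then have "x \<in> D" "l n *\<^sub>C x - F x = 0"
        using Suc by auto
      then show "x \<in> {0}"
        using no by (auto simp: eigenvalues_def)
    qed
  qed simp
  then have "generalized_eigenspace D F (l n) \<subseteq> {0}"
    unfolding generalized_eigenspace_def by blast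
  then have "algebraic_multiplicity D F (l n) \<le> card ({} :: 'a set)"
    unfolding algebraic_multiplicity_def by (intro complex_vector.dim_le_card) auto
  \<comment> \<open>Finiteness is recorded because \<open>card\<close> is 0 on infinite sets
    too.\<close>
  then have "card {m \<in> I. l m = l n} = 0" "finite {m \<in> I. l m = l n}"
    using assms(1) by (auto simp: lists_eigenvalues_def)
  then show False
    using assms(2) by auto
qed

text \<open>If \<open>S\<close> has simple eigenvalues in \<open>K\<close>, the components in the eigenspaces are split off one by one;
  \<open>e \<kappa> = 0\<close> is allowed, when \<open>\<kappa>\<close> is not an eigenvalue.\<close>

lemma poly_op_kernel_subset_span:
  fixes S :: "'a :: complex_hilbert \<Rightarrow> 'a"
  assumes S: "bounded_clinear S" and "finite K"
    and "\<And>\<kappa>. \<kappa> \<in> K \<Longrightarrow> S (e \<kappa>) = \<kappa> *\<^sub>C e \<kappa>"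
    and "\<And>\<kappa> x. \<kappa> \<in> K \<Longrightarrow> S x = \<kappa> *\<^sub>C x \<Longrightarrow> x \<in> complex_vector.span {e \<kappa>}"
    and "poly_op S (\<Prod>\<kappa>\<in>K. [:- \<kappa>, 1:]) x = 0"
  shows "x \<in> complex_vector.span (e ` K)"
  using assms(2-)
proof (induction K arbitrary: x rule: finite_induct)
  case empty
  then show ?case
    using poly_op_pCons [OF S, of 1 0 x]
    by (simp add: one_pCons poly_op_0 [OF S] bounded_clinear_zero [OF S] scaleC_one)
next
  case (insert \<kappa> K)
  let ?V = "complex_vector.span (e ` K)"
  \<comment> \<open>\<open>?W\<close> is the image of \<open>?V\<close> under
    \<open>S - \<kappa>\<close>. As \<kappa> is not in \<open>K\<close>, it contains
    \<open>?V\<close>; so \<open>S x - \<kappa> *\<^sub>C x\<close> has a preimage \<open>z\<close>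
    in \<open>?V\<close>, and \<open>x - z\<close> lies in the eigenspace of \<kappa>.\<close>
  let ?W = "{y. \<exists>z\<in>?V. y = S z - \<kappa> *\<^sub>C z}"
  have "poly_op S ((\<Prod>\<kappa>\<in>K. [:- \<kappa>, 1:]) * [:- \<kappa>, 1:]) x = 0"
    using insert.prems(3) insert.hyps by (simp add: mult.commute)
  then have "poly_op S (\<Prod>\<kappa>\<in>K. [:- \<kappa>, 1:]) (S x - \<kappa> *\<^sub>C x) = 0"
    unfolding poly_op_mult [OF S] poly_op_linear [OF S] .
  then have "S x - \<kappa> *\<^sub>C x \<in> ?V"
    using insert.prems by (intro insert.IH) auto
  moreover have "complex_vector.subspace ?W"
  proof (rule complex_vector.subspaceI)
    show "0 \<in> ?W"
      using complex_vector.span_zero by (force simp: bounded_clinear_zero [OF S])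
    show "y + y' \<in> ?W" if y: "y \<in> ?W" "y' \<in> ?W" for y y'
    proof -
      obtain z z' where "z \<in> ?V" "z' \<in> ?V" "y = S z - \<kappa> *\<^sub>C z" "y' = S z' - \<kappa> *\<^sub>C z'"
        using y by blast
      then show ?thesis
        by (auto intro!: bexI [of _ "z + z'"] simp: complex_vector.span_add
            bounded_clinear_add [OF S] scaleC_add_right)
    qed
    show "a *\<^sub>C y \<in> ?W" if y: "y \<in> ?W" for a y
    proof -
      obtain z where "z \<in> ?V" "y = S z - \<kappa> *\<^sub>C z"
        using y by blast
      then show ?thesis
        by (auto intro!: bexI [of _ "a *\<^sub>C z"] simp: complex_vector.span_scale
            bounded_clinear_scaleC [OF S] complex_vector.scale_right_diff_distrib scaleC_scaleC
            mult.commute)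
    qed
  qed
  moreover have "e ` K \<subseteq> ?W"
  proof
    fix y assume "y \<in> e ` K"
    then obtain \<nu> where \<nu>: "\<nu> \<in> K" "y = e \<nu>" by blast
    then have "\<nu> \<noteq> \<kappa>"
      using insert.hyps by auto
    \<comment> \<open>\<open>S - \<kappa>\<close> multiplies \<open>e \<nu>\<close> by
      \<open>\<nu> - \<kappa>\<close>, which is nonzero.\<close>
    let ?z = "(1 / (\<nu> - \<kappa>)) *\<^sub>C e \<nu>"
    have "S ?z - \<kappa> *\<^sub>C ?z = (\<nu> / (\<nu> - \<kappa>) - \<kappa> / (\<nu> - \<kappa>)) *\<^sub>C e \<nu>"
      using insert.prems(1) [of \<nu>] \<nu>(1)
      by (simp add: bounded_clinear_scaleC [OF S] scaleC_scaleC
          complex_vector.scale_left_diff_distrib)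
    also have "\<nu> / (\<nu> - \<kappa>) - \<kappa> / (\<nu> - \<kappa>) = 1"
      using \<open>\<nu> \<noteq> \<kappa>\<close> by (simp flip: diff_divide_distrib)
    finally have "y = S ?z - \<kappa> *\<^sub>C ?z"
      using \<nu>(2) by (simp add: scaleC_one)
    moreover have "?z \<in> ?V"
      using \<nu>(1) by (intro complex_vector.span_scale complex_vector.span_base) simp
    ultimately show "y \<in> ?W" by blast
  qed
  ultimately have "S x - \<kappa> *\<^sub>C x \<in> ?W"
    using complex_vector.span_minimal by blast
  then obtain z where z: "z \<in> ?V" "S x - \<kappa> *\<^sub>C x = S z - \<kappa> *\<^sub>C z" by blast
  then have "S (x - z) = \<kappa> *\<^sub>C (x - z)"
    by (simp add: bounded_clinear_diff [OF S] complex_vector.scale_right_diff_distrib algebra_simps)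
  then have "x - z \<in> complex_vector.span {e \<kappa>}"
    using insert.prems(2) by blast
  then have "x - z \<in> complex_vector.span (e ` insert \<kappa> K)"
    by (rule complex_vector.span_mono [THEN subsetD, rotated]) simp
  moreover have "z \<in> complex_vector.span (e ` insert \<kappa> K)"
    using z(1) by (rule complex_vector.span_mono [THEN subsetD, rotated]) auto
  ultimately show ?case
    using complex_vector.span_add by fastforce
qed


section \<open>Collocated self-adjoint systems\<close>

text \<open>One vector \<open>b\<close> serves for input and output; \<open>c = b\<close> is derived
  from the collocation condition in
  \<open>collocated_siso_if_collocated_self_adjoint\<close>.\<close>

locale collocated_siso = linear_op D A
  for D :: "'a :: complex_hilbert set" and A :: "'a \<Rightarrow> 'a" +
  fixes b :: 'a
  assumes system: "siso_system D A b b"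
    and minimal: "minimal_system D A b b"
    and symmetric: "x \<in> D \<Longrightarrow> y \<in> D \<Longrightarrow> cinner (A x) y = cinner x (A y)"
begin

lemma b_nonzero: "b \<noteq> 0"
  and discrete: "discrete_spectrum D A"
  using system by (auto simp: siso_system_def)

lemma spectrum_eq_eigenvalues: "spectrum D A = eigenvalues D A"
  using discrete eigenvalues_subset_spectrum by (auto simp: discrete_spectrum_def)

lemma resolvent_set_iff: "s \<in> resolvent_set D A \<longleftrightarrow> s \<notin> spectrum D A"
  by (simp add: spectrum_def)

section \<open>Reality of spectrum and zeros, simplicity of eigenvalues\<close>

lemma quadratic_form_real: "x \<in> D \<Longrightarrow> cinner (A x) x \<in> \<real>"
  using symmetric [of x x] cinner_commute [of "A x" x] by (simp add: Reals_cnj_iff)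

lemma real_if_quadratic_form_real:
  assumes "x \<noteq> 0" "cinner (\<mu> *\<^sub>C x) x \<in> \<real>"
  shows "\<mu> \<in> \<real>"
proof -
  have "\<mu> * complex_of_real ((norm x)\<^sup>2) \<in> \<real>"
    using assms(2) by (simp add: cinner_scaleC_left cinner_self)
  then have "\<mu> * complex_of_real ((norm x)\<^sup>2) / complex_of_real ((norm x)\<^sup>2) \<in> \<real>"
    by (intro Reals_divide) auto
  then show ?thesis
    using assms(1) by simp
qed

lemma spectrum_real: "spectrum D A \<subseteq> \<real>"
proof
  fix \<mu> assume "\<mu> \<in> spectrum D A"
  then obtain x where x: "x \<in> D" "x \<noteq> 0" "A x = \<mu> *\<^sub>C x"
    by (auto simp: spectrum_eq_eigenvalues eigenvalues_def)
  then show "\<mu> \<in> \<real>"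
    using real_if_quadratic_form_real [OF x(2)] quadratic_form_real [OF x(1)] by simp
qed

text \<open>The condition \<open>cinner x b = 0\<close> removes the input term from the pairing with
  \<open>x\<close>; the real quadratic form of \<open>A\<close> remains.\<close>

lemma invariant_zeros_real: "invariant_zeros D A b b \<subseteq> \<real>"
proof
  fix \<mu> assume "\<mu> \<in> invariant_zeros D A b b"
  then obtain x u where x: "x \<in> D" "x \<noteq> 0" "\<mu> *\<^sub>C x = A x + u *\<^sub>C b" "cinner x b = 0"
    by (auto simp: invariant_zeros_def input_op_def output_op_def algebra_simps)
  have "cinner b x = 0"
    using x(4) by (simp add: cinner_commute [of b x])
  then have "cinner (\<mu> *\<^sub>C x) x = cinner (A x) x"
    by (simp add: x(3) cinner_add_left cinner_scaleC_left)
  then show "\<mu> \<in> \<real>"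
    using real_if_quadratic_form_real [OF x(2)] quadratic_form_real [OF x(1)] by simp
qed

text \<open>Minimality as a Hautus test: an eigenvector with zero output would make its eigenvalue
  an invariant zero, with input 0.\<close>

lemma eigenvector_output_nonzero:
  assumes "v \<in> D" "v \<noteq> 0" "A v = \<mu> *\<^sub>C v"
  shows "cinner v b \<noteq> 0"
proof
  assume "cinner v b = 0"
  then have "\<mu> \<in> invariant_zeros D A b b"
    using assms by (auto simp: invariant_zeros_def input_op_def output_op_def
        intro!: bexI [of _ v] exI [of _ 0])
  moreover have "\<mu> \<in> spectrum D A"
    using assms by (auto simp: spectrum_eq_eigenvalues eigenvalues_def)
  ultimately show False
    using minimal by (auto simp: minimal_system_def)
qed

text \<open>Some combination \<open>w - a *\<^sub>C v\<close> has output 0, so by the previous lemma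
  it cannot be an eigenvector and must vanish.\<close>

lemma eigenspace_simple:
  assumes v: "v \<in> D" "v \<noteq> 0" "A v = \<mu> *\<^sub>C v" and w: "w \<in> D" "A w = \<mu> *\<^sub>C w"
  shows "\<exists>a. w = a *\<^sub>C v"
proof -
  define a where "a = cinner w b / cinner v b"
  have "cinner (w - a *\<^sub>C v) b = 0"
    using eigenvector_output_nonzero [OF v]
    by (simp add: cinner.diff_left cinner_scaleC_left a_def)
  moreover have "A (w - a *\<^sub>C v) = \<mu> *\<^sub>C (w - a *\<^sub>C v)"
    using v w by (simp add: A_diff A_scale scale_in_D complex_vector.scale_right_diff_distrib
        scaleC_scaleC mult.commute)
  moreover have "w - a *\<^sub>C v \<in> D"
    using v w by (simp add: diff_in_D scale_in_D)
  ultimately have "w - a *\<^sub>C v = 0"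
    using eigenvector_output_nonzero by blast
  then show ?thesis by auto
qed

lemma symmetric_R:
  assumes "complex_of_real t \<in> resolvent_set D A"
  shows "symmetric_op (R (complex_of_real t))"
  unfolding symmetric_op_def
proof (intro allI)
  fix x y
  let ?u = "R (complex_of_real t) x" and ?w = "R (complex_of_real t) y"
  have "cinner ?u (t *\<^sub>C ?w - A ?w) = cinner (t *\<^sub>C ?u - A ?u) ?w"
    by (simp add: cinner.diff_left cinner.diff_right cinner_scaleC_left cinner_scaleC_right
        symmetric R_in_D [OF assms])
  then show "cinner ?u y = cinner x ?w"
    by (simp add: pencil_R [OF assms])
qed

lemma R_eigenvector:
  assumes s: "s \<in> resolvent_set D A" and v: "v \<in> D" "A v = \<mu> *\<^sub>C v" "s \<noteq> \<mu>"
  shows "R s v = (1 / (s - \<mu>)) *\<^sub>C v"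
proof (rule R_eqI [OF s])
  show "(1 / (s - \<mu>)) *\<^sub>C v \<in> D"
    using v by (simp add: scale_in_D)
  show "s *\<^sub>C (1 / (s - \<mu>)) *\<^sub>C v - A ((1 / (s - \<mu>)) *\<^sub>C v) = v"
    unfolding pencil_scale [OF v(1)] v(2) complex_vector.scale_left_diff_distrib [symmetric]
    using v(3) by (simp add: scaleC_scaleC scaleC_one)
qed

text \<open>The spectrum is closed and consists of isolated points, so it has no limit point and
  meets a compact segment in a finite set.\<close>

lemma finite_spectrum_interval: "finite {t \<in> {p..q}. complex_of_real t \<in> spectrum D A}"
proof -
  have "finite (complex_of_real ` {p..q} \<inter> spectrum D A)"
  proof (rule finite_not_islimpt_in_compact)
    show "compact (complex_of_real ` {p..q})"
      by (intro compact_continuous_image continuous_intros compact_Icc)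
    show "\<not> z islimpt spectrum D A" for z
      using discrete closed_spectrum
      by (auto simp: discrete_spectrum_def isolated_in_islimpt_iff closed_limpt)
  qed
  then have "finite (complex_of_real ` {t \<in> {p..q}. complex_of_real t \<in> spectrum D A})"
    by (rule finite_subset [rotated]) auto
  then show ?thesis
    by (rule finite_imageD) (simp add: inj_on_def)
qed

text \<open>Provides a gap free of spectrum to the right of \<open>p\<close>, on which
  \<open>G\<close> is differentiable.\<close>

lemma next_eigenvalue:
  assumes "p < q" "complex_of_real q \<in> spectrum D A"
  obtains q' where "p < q'" "q' \<le> q" "complex_of_real q' \<in> spectrum D A"
    "\<And>t. p < t \<Longrightarrow> t < q' \<Longrightarrow> complex_of_real t \<in> resolvent_set D A"
proof -
  define F where "F = {t \<in> {p<..q}. complex_of_real t \<in> spectrum D A}"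
  have fin: "finite F"
    unfolding F_def by (rule finite_subset [OF _ finite_spectrum_interval [of p q]]) auto
  have "q \<in> F"
    using assms by (simp add: F_def)
  then have "Min F \<in> F"
    using fin Min_in by blast
  show thesis
  proof (rule that [of "Min F"])
    show "p < Min F" "Min F \<le> q" "complex_of_real (Min F) \<in> spectrum D A"
      using \<open>Min F \<in> F\<close> by (simp_all add: F_def)
    show "complex_of_real t \<in> resolvent_set D A" if "p < t" "t < Min F" for t
    proof (rule ccontr)
      assume "complex_of_real t \<notin> resolvent_set D A"
      then have "t \<in> F"
        using that \<open>Min F \<le> q\<close> by (simp add: F_def resolvent_set_iff)
      then show False
        using fin that(2) by (simp add: Min_le leD)
    qed
  qed
qed


subsection \<open>The transfer function on the real line\<close>

text \<open>The real part makes the intermediate value theorem and derivative tests applicable; by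
  \<open>cinner_R\<close> nothing is lost at real points of the resolvent set. At eigenvalues the
  value carries no information.\<close>

definition G :: "real \<Rightarrow> real"
  where "G t = Re (cinner (R (complex_of_real t) b) b)"

lemma cinner_R:
  assumes "complex_of_real t \<in> resolvent_set D A"
  shows "cinner (R (complex_of_real t) b) b = complex_of_real (G t)"
proof -
  have "cinner (R (complex_of_real t) b) b = cinner b (R (complex_of_real t) b)"
    using symmetric_R [OF assms] by (simp add: symmetric_op_def)
  also have "\<dots> = cnj (cinner (R (complex_of_real t) b) b)"
    by (rule cinner_commute)
  finally have "cinner (R (complex_of_real t) b) b \<in> \<real>"
    by (simp add: Reals_cnj_iff)
  then show ?thesis
    by (simp add: G_def)
qed

lemma invariant_zero_iff:
  "complex_of_real t \<in> invariant_zeros D A b b \<longleftrightarrow>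
    complex_of_real t \<in> resolvent_set D A \<and> G t = 0"
  unfolding invariant_zeros_eq_transmission_zeros [OF system minimal]
  using cinner_R [of t]
  by (auto simp: transmission_zeros_def transfer_function_def output_op_def input_op_def scaleC_one)

text \<open>By the resolvent identity and symmetry the difference quotient is exactly
  \<open>- Re (cinner (R t b) (R s b))\<close>, and the resolvent is continuous.\<close>

lemma G_deriv:
  assumes t: "complex_of_real t \<in> resolvent_set D A"
  shows "(G has_real_derivative - (norm (R (complex_of_real t) b))\<^sup>2) (at t)"
proof -
  let ?x = "\<lambda>s. R (complex_of_real s) b"
  have "isCont (\<lambda>s. ?x s) t"
    using isCont_o2 [of t complex_of_real "\<lambda>s. R s b"] isCont_R [OF t] by simp
  then have "((\<lambda>s. - Re (cinner (?x t) (?x s))) \<longlongrightarrow> - Re (cinner (?x t) (?x t))) (at t)"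
    unfolding isCont_def by (intro tendsto_intros cinner.tendsto)
  then have lim: "((\<lambda>s. - Re (cinner (?x t) (?x s))) \<longlongrightarrow> - (norm (?x t))\<^sup>2) (at t)"
    by (simp add: cinner_self)
  obtain K where "\<forall>\<^sub>F s in nhds (complex_of_real t).
      s \<in> resolvent_set D A \<and> (\<forall>y. norm (R s y) \<le> K * norm y)"
    by (rule resolvent_nbhd [OF t])
  then have "\<forall>\<^sub>F s in nhds (complex_of_real t). s \<in> resolvent_set D A"
    by (rule eventually_mono) simp
  moreover have "filterlim complex_of_real (nhds (complex_of_real t)) (at t)"
    by (intro tendsto_intros)
  ultimately have "\<forall>\<^sub>F s in at t. complex_of_real s \<in> resolvent_set D A"
    by (rule eventually_compose_filterlim)
  moreover have "\<forall>\<^sub>F s in at t. s \<noteq> t"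
    by (rule eventually_neq_at_within)
  ultimately have "\<forall>\<^sub>F s in at t. - Re (cinner (?x t) (?x s)) = (G s - G t) / (s - t)"
  proof eventually_elim
    case (elim s)
    have "complex_of_real (G s - G t) = cinner (?x s - ?x t) b"
      by (simp add: cinner_R elim t cinner.diff_left)
    also have "\<dots> = complex_of_real (t - s) * cinner (R (complex_of_real s) (?x t)) b"
      unfolding resolvent_identity [OF elim(1) t] by (simp add: cinner_scaleC_left)
    also have "cinner (R (complex_of_real s) (?x t)) b = cinner (?x t) (?x s)"
      using symmetric_R [OF elim(1)] by (simp add: symmetric_op_def)
    finally have "Re (complex_of_real (G s - G t)) = Re (complex_of_real (t - s) * cinner (?x t) (?x s))"
      by (rule arg_cong)
    then have "G s - G t = (t - s) * Re (cinner (?x t) (?x s))"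
      by simp
    then show ?case
      using elim(2) by (simp add: field_simps)
  qed
  then show ?thesis
    unfolding has_field_derivative_iff by (rule Lim_transform_eventually [OF lim])
qed

lemma isCont_G: "complex_of_real t \<in> resolvent_set D A \<Longrightarrow> isCont G t"
  using G_deriv DERIV_isCont by blast

lemma R_b_nonzero:
  assumes "s \<in> resolvent_set D A"
  shows "R s b \<noteq> 0"
proof
  assume "R s b = 0"
  \<comment> \<open>\<open>A 0\<close> is written with a multiple of a vector of \<open>D\<close>,
    so that homogeneity of \<open>A\<close> evaluates it to 0.\<close>
  then have "b = s *\<^sub>C 0 - A (0 *\<^sub>C R s b)"
    using pencil_R [OF assms, of b] by simp
  then have "b = 0"
    unfolding A_scale [OF R_in_D [OF assms]] by simp
  then show False
    using b_nonzero by simp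
qed

lemma G_decreasing:
  assumes "p < q" "\<And>t. p \<le> t \<Longrightarrow> t \<le> q \<Longrightarrow> complex_of_real t \<in> resolvent_set D A"
  shows "G q < G p"
proof (rule DERIV_neg_imp_decreasing [OF assms(1)])
  fix t assume "p \<le> t" "t \<le> q"
  then have t: "complex_of_real t \<in> resolvent_set D A"
    by (rule assms(2))
  show "\<exists>y. (G has_real_derivative y) (at t) \<and> y < 0"
    using G_deriv [OF t] R_b_nonzero [OF t] by (intro exI conjI) auto
qed

text \<open>The derivative of \<open>G t\<close> is at most that of its singular part at \<open>l\<close>, because the component of
  \<open>R t b\<close> along the eigenvector has norm \<open>\<surd>r / \<bar>t - l\<bar>\<close>. This replaces the spectral expansion of \<open>G\<close>.\<close>

lemma G_singular_part:
  assumes l: "complex_of_real l \<in> spectrum D A"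
  obtains r where "r > 0"
    "\<And>p q. p < q \<Longrightarrow> (\<And>t. p \<le> t \<Longrightarrow> t \<le> q \<Longrightarrow> complex_of_real t \<in> resolvent_set D A) \<Longrightarrow>
      G q - r / (q - l) \<le> G p - r / (p - l)"
proof -
  obtain v where v: "v \<in> D" "v \<noteq> 0" "A v = complex_of_real l *\<^sub>C v"
    using l by (auto simp: spectrum_eq_eigenvalues eigenvalues_def)
  \<comment> \<open>The squared norm of the projection of \<open>b\<close> onto the eigenvector,
    that is, the residue of the transfer function at \<open>l\<close>. Minimality makes it
    positive.\<close>
  define r where "r = (cmod (cinner b v) / norm v)\<^sup>2"
  have "cinner b v \<noteq> 0"
    using eigenvector_output_nonzero [OF v] cinner_commute [of v b] by auto
  then have "r > 0"
    using v(2) by (simp add: r_def)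
  moreover have "G q - r / (q - l) \<le> G p - r / (p - l)"
    if "p < q" and rho: "\<And>t. p \<le> t \<Longrightarrow> t \<le> q \<Longrightarrow> complex_of_real t \<in> resolvent_set D A" for p q
  proof (rule DERIV_nonpos_imp_nonincreasing [of p q "\<lambda>t. G t - r / (t - l)"])
    show "p \<le> q" using that(1) by simp
  next
    fix t assume "p \<le> t" "t \<le> q"
    then have t: "complex_of_real t \<in> resolvent_set D A"
      by (rule rho)
    let ?x = "R (complex_of_real t) b"
    have neq: "t \<noteq> l"
      using t l by (auto simp: resolvent_set_iff)
    have "cinner ?x v = cinner b v / complex_of_real (t - l)"
      using symmetric_R [OF t] R_eigenvector [OF t v(1,3)] neq
      by (simp add: symmetric_op_def cinner_scaleC_right)
    then have "cmod (cinner b v) / \<bar>t - l\<bar> = cmod (cinner ?x v)"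
      by (simp add: norm_divide flip: of_real_diff)
    also have "\<dots> \<le> norm ?x * norm v"
      by (rule cauchy_schwarz)
    finally have "cmod (cinner b v) / \<bar>t - l\<bar> / norm v \<le> norm ?x"
      using v(2) by (subst pos_divide_le_eq) auto
    then have "cmod (cinner b v) / norm v / \<bar>t - l\<bar> \<le> norm ?x"
      by (simp add: mult.commute)
    then have "(cmod (cinner b v) / norm v / \<bar>t - l\<bar>)\<^sup>2 \<le> (norm ?x)\<^sup>2"
      by (intro power_mono) auto
    then have "- (norm ?x)\<^sup>2 + r / (t - l)\<^sup>2 \<le> 0"
      by (simp add: r_def power_divide power_mult_distrib)
    moreover have "((\<lambda>t. G t - r / (t - l)) has_real_derivative - (norm ?x)\<^sup>2 + r / (t - l)\<^sup>2) (at t)"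
      using neq by (auto intro!: derivative_eq_intros G_deriv [OF t] simp: power2_eq_square)
    ultimately show "\<exists>y. ((\<lambda>t. G t - r / (t - l)) has_real_derivative y) (at t) \<and> y \<le> 0"
      by blast
  qed
  ultimately show thesis
    by (rule that)
qed

text \<open>\<open>G t - r / (t - l)\<close> is nonincreasing, so to the left of the midpoint
  \<open>m\<close> it stays above its value \<open>C\<close> at \<open>m\<close>, and close to
  \<open>l\<close> the pole term dominates \<open>C\<close>.\<close>

lemma G_positive_right:
  assumes l: "complex_of_real l \<in> spectrum D A" and "l < q"
    and rho: "\<And>t. l < t \<Longrightarrow> t < q \<Longrightarrow> complex_of_real t \<in> resolvent_set D A"
  obtains t where "l < t" "t < q" "G t > 0"
proof -
  obtain r where r: "r > 0"
    "\<And>p q. p < q \<Longrightarrow> (\<And>t. p \<le> t \<Longrightarrow> t \<le> q \<Longrightarrow> complex_of_real t \<in> resolvent_set D A) \<Longrightarrow>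
      G q - r / (q - l) \<le> G p - r / (p - l)"
    using G_singular_part [OF l] by metis
  define m where "m = (l + q) / 2"
  define C where "C = G m - r / (m - l)"
  \<comment> \<open>The first bound keeps \<open>l + d\<close> left of \<open>m\<close>; the second
    makes \<open>r / d\<close> exceed the absolute value of \<open>C\<close>.\<close>
  define d where "d = min ((m - l) / 2) (r / (\<bar>C\<bar> + 1))"
  have m: "l < m" "m < q"
    using \<open>l < q\<close> by (simp_all add: m_def)
  have d: "0 < d" "d < m - l" "d \<le> r / (\<bar>C\<bar> + 1)"
    using m r(1) by (auto simp: d_def min_less_iff_disj)
  have "C \<le> G (l + d) - r / d"
    using r(2) [of "l + d" m] d m rho by (simp add: C_def)
  moreover have "\<bar>C\<bar> + 1 \<le> r / d"
    using d(1,3) by (simp add: field_simps)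
  ultimately have "G (l + d) > 0" by linarith
  then show thesis
    using d m by (intro that [of "l + d"]) auto
qed

text \<open>Mirror image of \<open>G_positive_right\<close>: left of \<open>l\<close> the pole term
  is negative.\<close>

lemma G_negative_left:
  assumes l: "complex_of_real l \<in> spectrum D A" and "p < l"
    and rho: "\<And>t. p < t \<Longrightarrow> t < l \<Longrightarrow> complex_of_real t \<in> resolvent_set D A"
  obtains t where "p < t" "t < l" "G t < 0"
proof -
  obtain r where r: "r > 0"
    "\<And>p q. p < q \<Longrightarrow> (\<And>t. p \<le> t \<Longrightarrow> t \<le> q \<Longrightarrow> complex_of_real t \<in> resolvent_set D A) \<Longrightarrow>
      G q - r / (q - l) \<le> G p - r / (p - l)"
    using G_singular_part [OF l] by metis
  define m where "m = (l + p) / 2"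
  define C where "C = G m - r / (m - l)"
  define d where "d = min ((l - m) / 2) (r / (\<bar>C\<bar> + 1))"
  have m: "p < m" "m < l"
    using \<open>p < l\<close> by (simp_all add: m_def)
  have d: "0 < d" "d < l - m" "d \<le> r / (\<bar>C\<bar> + 1)"
    using m r(1) by (auto simp: d_def min_less_iff_disj)
  have "G (l - d) + r / d \<le> C"
    using r(2) [of m "l - d"] d m rho by (simp add: C_def)
  moreover have "\<bar>C\<bar> + 1 \<le> r / d"
    using d(1,3) by (simp add: field_simps)
  ultimately have "G (l - d) < 0" by linarith
  then show thesis
    using d m by (intro that [of "l - d"]) auto
qed

text \<open>Up to the next eigenvalue \<open>q'\<close> the function \<open>G\<close> is continuous,
  and it goes from positive values near \<open>p\<close> to negative ones near
  \<open>q'\<close>.\<close>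

lemma zero_between_eigenvalues:
  assumes p: "complex_of_real p \<in> spectrum D A" and q: "complex_of_real q \<in> spectrum D A" and "p < q"
  obtains z where "p < z" "z < q" "complex_of_real z \<in> invariant_zeros D A b b"
proof -
  obtain q' where q': "p < q'" "q' \<le> q" "complex_of_real q' \<in> spectrum D A"
    and rho: "\<And>t. p < t \<Longrightarrow> t < q' \<Longrightarrow> complex_of_real t \<in> resolvent_set D A"
    using next_eigenvalue [OF \<open>p < q\<close> q] by metis
  obtain s where s: "p < s" "s < q'" "G s > 0"
    using G_positive_right [OF p q'(1) rho] by metis
  obtain t where t: "s < t" "t < q'" "G t < 0"
    using G_negative_left [OF q'(3) s(2)] rho s(1) by (metis less_trans)
  have "\<exists>z. s \<le> z \<and> z \<le> t \<and> G z = 0"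
  proof (rule IVT2)
    show "\<forall>z. s \<le> z \<and> z \<le> t \<longrightarrow> isCont G z"
      using s t rho by (auto intro!: isCont_G)
  qed (use s t in auto)
  then obtain z where "s \<le> z" "z \<le> t" "G z = 0" by blast
  then show thesis
    using s t q' rho by (intro that [of z]) (auto simp: invariant_zero_iff)
qed

text \<open>Without spectrum in between, \<open>G\<close> would be strictly decreasing from the
  value 0 to the value 0.\<close>

lemma eigenvalue_between_zeros:
  assumes "complex_of_real p \<in> invariant_zeros D A b b" "complex_of_real q \<in> invariant_zeros D A b b"
    and "p < q"
  obtains t where "p < t" "t < q" "complex_of_real t \<in> spectrum D A"
proof -
  have pq: "complex_of_real p \<in> resolvent_set D A" "complex_of_real q \<in> resolvent_set D A" "G p = G q"
    using assms(1,2) by (simp_all add: invariant_zero_iff)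
  have "\<not> (\<forall>t. p \<le> t \<and> t \<le> q \<longrightarrow> complex_of_real t \<in> resolvent_set D A)"
    using G_decreasing [OF \<open>p < q\<close>] pq(3) by auto
  then obtain t where "p \<le> t" "t \<le> q" "complex_of_real t \<in> spectrum D A"
    by (auto simp: resolvent_set_iff)
  moreover from this have "t \<noteq> p" "t \<noteq> q"
    using pq by (auto simp: resolvent_set_iff)
  ultimately show thesis
    by (intro that [of t]) auto
qed

lemma interlacing: "interlace (invariant_zeros D A b b) (eigenvalues D A)"
  unfolding interlace_def
proof (intro conjI ballI impI)
  show "invariant_zeros D A b b \<subseteq> \<real>"
    by (rule invariant_zeros_real)
  show "eigenvalues D A \<subseteq> \<real>"
    using spectrum_real by (simp add: spectrum_eq_eigenvalues)
  show "invariant_zeros D A b b \<inter> eigenvalues D A = {}"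
    using minimal by (simp add: minimal_system_def spectrum_eq_eigenvalues)
next
  fix p q assume "p \<in> invariant_zeros D A b b" "q \<in> invariant_zeros D A b b" "Re p < Re q"
  moreover from this have "p = complex_of_real (Re p)" "q = complex_of_real (Re q)"
    using invariant_zeros_real by (auto simp: subset_iff)
  ultimately show "\<exists>r\<in>eigenvalues D A. Re p < Re r \<and> Re r < Re q"
    by (metis eigenvalue_between_zeros Re_complex_of_real spectrum_eq_eigenvalues)
next
  fix p q assume "p \<in> eigenvalues D A" "q \<in> eigenvalues D A" "Re p < Re q"
  moreover from this have "p = complex_of_real (Re p)" "q = complex_of_real (Re q)"
    using spectrum_real by (auto simp: subset_iff spectrum_eq_eigenvalues)
  ultimately show "\<exists>r\<in>invariant_zeros D A b b. Re p < Re r \<and> Re r < Re q"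
    by (metis zero_between_eigenvalues Re_complex_of_real spectrum_eq_eigenvalues)
qed


subsection \<open>The eigenvalues are unbounded below and bounded above\<close>

text \<open>On the one-dimensional eigenspace the semigroup \<open>T\<close> acts as a scalar \<open>g\<close>, so that \<open>T 1 v\<close> is
  \<open>g (1 / n) ^ n\<close> times \<open>v\<close>, where \<open>g (1 / n)\<close> exceeds \<open>1 + (t - 1) / n\<close> for large \<open>n\<close>.\<close>

lemma semigroup_eigenvalue_bound:
  assumes sg: "c0_semigroup T" and gen: "is_generator_of D A T"
    and t: "complex_of_real t \<in> spectrum D A"
  shows "t \<le> max 1 (onorm (T 1))"
proof (cases "t \<le> 1")
  case False
  let ?\<mu> = "complex_of_real t"
  obtain v where v: "v \<in> D" "v \<noteq> 0" "A v = ?\<mu> *\<^sub>C v"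
    using t by (auto simp: spectrum_eq_eigenvalues eigenvalues_def)
  have Tbc: "bounded_clinear (T h)" if "h \<ge> 0" for h
    using sg that by (simp add: c0_semigroup_def)
  have Tadd: "T (h + h') x = T h (T h' x)" if "h \<ge> 0" "h' \<ge> 0" for h h' x
    using sg that by (simp add: c0_semigroup_def)
  have T0: "T 0 x = x" for x
    using sg by (simp add: c0_semigroup_def)
  have der: "((\<lambda>h. (1 / h) *\<^sub>R (T h v - v)) \<longlongrightarrow> ?\<mu> *\<^sub>C v) (at_right 0)"
    using gen v unfolding is_generator_of_def by metis
  \<comment> \<open>\<open>T h\<close> commutes with the difference quotients defining the
    generator, so \<open>T h v\<close> solves the same eigenvalue equation, and the eigenspace is
    one-dimensional.\<close>
  have "\<exists>a. T h v = a *\<^sub>C v" if h: "h \<ge> 0" for h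
  proof -
    interpret Th: bounded_linear "T h"
      using Tbc [OF h] by (simp add: bounded_clinear_def)
    have "((\<lambda>h'. T h ((1 / h') *\<^sub>R (T h' v - v))) \<longlongrightarrow> T h (?\<mu> *\<^sub>C v)) (at_right 0)"
      by (rule Th.tendsto [OF der])
    moreover have "\<forall>\<^sub>F h' in at_right 0.
        T h ((1 / h') *\<^sub>R (T h' v - v)) = (1 / h') *\<^sub>R (T h' (T h v) - T h v)"
      using eventually_at_right_less [of 0]
    proof eventually_elim
      case (elim h')
      then have "T h (T h' v) = T h' (T h v)"
        using Tadd [of h h' v] Tadd [of h' h v] h by (simp add: add.commute)
      then show ?case
        by (simp add: Th.scaleR Th.diff)
    qed
    ultimately have "((\<lambda>h'. (1 / h') *\<^sub>R (T h' (T h v) - T h v)) \<longlongrightarrow> T h (?\<mu> *\<^sub>C v)) (at_right 0)"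
      by (rule Lim_transform_eventually)
    then have "T h v \<in> D" "A (T h v) = T h (?\<mu> *\<^sub>C v)"
      using gen by (auto simp: is_generator_of_def)
    then show ?thesis
      using eigenspace_simple [OF v] bounded_clinear_scaleC [OF Tbc [OF h]] by simp
  qed
  then obtain g where g: "\<And>h. h \<ge> 0 \<Longrightarrow> T h v = g h *\<^sub>C v"
    by metis
  have iter: "T (real k * h) v = (g h ^ k) *\<^sub>C v" if h: "h \<ge> 0" for k h
  proof (induction k)
    case 0
    then show ?case by (simp add: T0 scaleC_one)
  next
    case (Suc k)
    have "T (real (Suc k) * h) v = T h (T (real k * h) v)"
      using Tadd [of h "real k * h" v] h by (simp add: algebra_simps)
    also have "\<dots> = (g h ^ Suc k) *\<^sub>C v"
      using Suc h by (simp add: bounded_clinear_scaleC [OF Tbc] g scaleC_scaleC mult.commute)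
    finally show ?case .
  qed
  \<comment> \<open>The tolerance \<open>norm v\<close> means an error below 1 for the quotient
    \<open>(g h - 1) / h\<close>, which accounts for \<open>t - 1\<close> in place of
    \<open>t\<close> below.\<close>
  have "\<forall>\<^sub>F h in at_right 0. dist ((1 / h) *\<^sub>R (T h v - v)) (?\<mu> *\<^sub>C v) < norm v"
    using tendstoD [OF der] v(2) by simp
  then have ev: "\<forall>\<^sub>F h in at_right 0. 1 + h * (t - 1) \<le> cmod (g h)"
    using eventually_at_right_less [of 0]
  proof eventually_elim
    case (elim h)
    have "(1 / h) *\<^sub>R (T h v - v) - ?\<mu> *\<^sub>C v = ((g h - 1) / h - ?\<mu>) *\<^sub>C v"
      using elim(2) by (simp add: g scaleR_eq_scaleC complex_vector.scale_left_diff_distrib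
          complex_vector.scale_right_diff_distrib scaleC_scaleC scaleC_one diff_divide_distrib)
    then have "cmod ((g h - 1) / h - ?\<mu>) * norm v < 1 * norm v"
      using elim(1) by (simp add: dist_norm)
    then have "cmod ((g h - 1) / h - ?\<mu>) < 1"
      using v(2) mult_less_cancel_right_pos zero_less_norm_iff by blast
    then have "Re (?\<mu> - (g h - 1) / h) < 1"
      using complex_Re_le_cmod [of "?\<mu> - (g h - 1) / h"] by (simp add: norm_minus_commute)
    then have "t - 1 < (Re (g h) - 1) / h"
      by simp
    then have "1 + h * (t - 1) < Re (g h)"
      using elim(2) by (simp add: field_simps)
    then show ?case
      using complex_Re_le_cmod [of "g h"] by linarith
  qed
  have "filterlim (\<lambda>n. 1 / real (Suc n)) (at_right 0) sequentially"
    using LIMSEQ_Suc [OF lim_1_over_n]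
    by (auto simp: filterlim_at eventually_sequentially)
  then have "\<forall>\<^sub>F n in sequentially. 1 + 1 / real (Suc n) * (t - 1) \<le> cmod (g (1 / real (Suc n)))"
    by (rule eventually_compose_filterlim [OF ev])
  then obtain n where n: "1 + 1 / real (Suc n) * (t - 1) \<le> cmod (g (1 / real (Suc n)))"
    by (auto simp: eventually_sequentially)
  \<comment> \<open>Written in this form for Bernoulli's inequality; \<open>t > 1\<close> keeps the
    base nonnegative.\<close>
  have "t = 1 + real (Suc n) * (1 / real (Suc n) * (t - 1))"
    by (simp add: field_simps)
  also have "\<dots> \<le> (1 + 1 / real (Suc n) * (t - 1)) ^ Suc n"
    using False by (intro Bernoulli_inequality) (simp add: order_trans [of _ 0])
  also have "\<dots> \<le> cmod (g (1 / real (Suc n))) ^ Suc n"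
    using n False by (intro power_mono) auto
  finally have "t * norm v \<le> norm ((g (1 / real (Suc n)) ^ Suc n) *\<^sub>C v)"
    by (simp add: mult_right_mono norm_power norm_mult)
  also have "\<dots> = norm (T 1 v)"
    using iter [of "1 / real (Suc n)" "Suc n"] by (simp del: of_nat_Suc)
  also have "\<dots> \<le> onorm (T 1) * norm v"
    using Tbc [of 1] by (intro onorm) (simp add: bounded_clinear_def)
  finally show ?thesis
    using v(2) by simp
qed simp

lemma spectrum_bounded_above: obtains M where "\<And>t. complex_of_real t \<in> spectrum D A \<Longrightarrow> t \<le> M"
  using system semigroup_eigenvalue_bound
  by (auto simp: siso_system_def generates_c0_semigroup_def)

text \<open>Spectral mapping for the resolvent, where \<open>r\<close> corresponds to
  \<open>s - 1 / r\<close>. With \<open>u = R s x\<close> and \<open>y = u - r *\<^sub>C x\<close>,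
  the pencil at \<open>s - 1 / r\<close> maps \<open>u\<close> to a multiple of \<open>y\<close>. So
  \<open>y\<close> controls \<open>u\<close>, and then also \<open>x\<close>.\<close>

lemma bounded_below_R_shift:
  assumes s: "s \<in> resolvent_set D A" and "r \<noteq> 0" and t: "s - 1 / r \<in> resolvent_set D A"
  shows "bounded_below (\<lambda>x. R s x - r *\<^sub>C x)"
proof -
  obtain C where C: "C > 0" "\<And>y. norm (R (s - 1 / r) y) \<le> C * norm y"
    using R_bound [OF t] by metis
  define c where "c = C / cmod r + 1"
  have "c > 0"
    using C(1) by (simp add: c_def add_nonneg_pos)
  have "cmod r / c * norm x \<le> norm (R s x - r *\<^sub>C x)" for x
  proof -
    let ?u = "R s x" and ?y = "R s x - r *\<^sub>C x"
    have "(s - 1 / r) *\<^sub>C ?u - A ?u = (- (1 / r)) *\<^sub>C ?y"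
      using pencil_shift [of "s - 1 / r" ?u s] \<open>r \<noteq> 0\<close>
      by (simp add: pencil_R [OF s] complex_vector.scale_right_diff_distrib scaleC_scaleC scaleC_one)
    then have "?u = R (s - 1 / r) ((- (1 / r)) *\<^sub>C ?y)"
      using R_pencil [OF t R_in_D [OF s]] by metis
    then have "norm ?u \<le> C * (norm ?y / cmod r)"
      using C(2) [of "(- (1 / r)) *\<^sub>C ?y"] by (simp add: norm_divide)
    moreover have "cmod r * norm x \<le> norm ?u + norm ?y"
      using norm_triangle_ineq4 [of ?u ?y] by simp
    ultimately have "cmod r * norm x \<le> c * norm ?y"
      by (simp add: c_def algebra_simps)
    then show ?thesis
      using \<open>c > 0\<close> by (simp add: divide_le_eq mult.commute)
  qed
  then show ?thesis
    using \<open>c > 0\<close> \<open>r \<noteq> 0\<close> by (auto simp: bounded_below_def intro!: exI [of _ "cmod r / c"])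
qed

text \<open>A resolvent operator \<open>S\<close> at a real point is bounded and symmetric with
  spectrum in a finite set \<open>K\<close>. Hence the product of the factors
  \<open>S - \<kappa>\<close> over \<open>K\<close> vanishes, and every vector is a combination of
  eigenvectors, one for each point of \<open>K\<close>.\<close>

lemma finite_dimensional_if_finite_spectrum:
  assumes fin: "finite (spectrum D A)"
  shows "finite_dimensional (UNIV :: 'a set)"
proof -
  obtain M where M: "\<And>t. complex_of_real t \<in> spectrum D A \<Longrightarrow> t \<le> M"
    using spectrum_bounded_above by metis
  define s where "s = complex_of_real (M + 1)"
  define S where "S = R s"
  \<comment> \<open>The point 0 is included because \<open>bounded_below_R_shift\<close> does not
    cover \<open>r = 0\<close>. Its eigenspace under the injective \<open>S\<close> is zero, so the
    vector 0 represents it below.\<close>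
  define K where "K = insert 0 ((\<lambda>\<mu>. 1 / (s - \<mu>)) ` spectrum D A)"
  have s: "s \<in> resolvent_set D A"
    using M [of "M + 1"] by (auto simp: s_def resolvent_set_iff)
  have S: "bounded_clinear S" "symmetric_op S"
    using bounded_clinear_R [OF s] symmetric_R [OF s [unfolded s_def]]
    by (simp_all only: S_def s_def)
  have "\<exists>v. S v = \<kappa> *\<^sub>C v \<and> (\<forall>x. S x = \<kappa> *\<^sub>C x \<longrightarrow> x \<in> complex_vector.span {v})"
    if "\<kappa> \<in> K" for \<kappa>
  proof (cases "\<kappa> = 0")
    case True
    have "x = 0" if "S x = 0" for x
    proof -
      have "x = s *\<^sub>C 0 - A (0 *\<^sub>C R s x)"
        using pencil_R [OF s, of x] that by (simp add: S_def)
      then show ?thesis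
        unfolding A_scale [OF R_in_D [OF s]] by simp
    qed
    then show ?thesis
      using True by (intro exI [of _ 0]) (auto simp: bounded_clinear_zero [OF S(1)])
  next
    case False
    then obtain \<mu> where \<mu>: "\<mu> \<in> spectrum D A" "\<kappa> = 1 / (s - \<mu>)"
      using \<open>\<kappa> \<in> K\<close> by (auto simp: K_def)
    obtain v where v: "v \<in> D" "v \<noteq> 0" "A v = \<mu> *\<^sub>C v"
      using \<mu>(1) by (auto simp: spectrum_eq_eigenvalues eigenvalues_def)
    have "s \<noteq> \<mu>"
      using False \<mu>(2) by auto
    have "x \<in> complex_vector.span {v}" if x: "S x = \<kappa> *\<^sub>C x" for x
    proof -
      \<comment> \<open>An eigenvector of \<open>S\<close> for nonzero \<kappa> is a multiple of a
        value of the resolvent, hence in \<open>D\<close>.\<close>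
      have "(1 / \<kappa>) *\<^sub>C S x = x"
        unfolding x using False by (simp add: scaleC_scaleC scaleC_one)
      then have "x \<in> D"
        using scale_in_D [OF R_in_D [OF s, of x], of "1 / \<kappa>"] by (simp add: S_def)
      have "\<kappa> *\<^sub>C (s *\<^sub>C x - A x) = x"
        using pencil_R [OF s, of x] x pencil_scale [OF \<open>x \<in> D\<close>, of s \<kappa>] by (simp add: S_def)
      then have "(s - \<mu>) *\<^sub>C \<kappa> *\<^sub>C (s *\<^sub>C x - A x) = (s - \<mu>) *\<^sub>C x"
        by simp
      then have "s *\<^sub>C x - A x = (s - \<mu>) *\<^sub>C x"
        using \<mu>(2) \<open>s \<noteq> \<mu>\<close> by (simp add: scaleC_scaleC scaleC_one)
      then have "A x = \<mu> *\<^sub>C x"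
        by (simp add: complex_vector.scale_left_diff_distrib)
      then obtain a where "x = a *\<^sub>C v"
        using eigenspace_simple [OF v \<open>x \<in> D\<close>] by blast
      then show ?thesis
        by (simp add: complex_vector.span_scale complex_vector.span_base)
    qed
    moreover have "S v = \<kappa> *\<^sub>C v"
      using R_eigenvector [OF s v(1,3) \<open>s \<noteq> \<mu>\<close>] by (simp add: S_def \<mu>(2))
    ultimately show ?thesis by blast
  qed
  then obtain e where e: "\<And>\<kappa>. \<kappa> \<in> K \<Longrightarrow> S (e \<kappa>) = \<kappa> *\<^sub>C e \<kappa>"
    "\<And>\<kappa> x. \<kappa> \<in> K \<Longrightarrow> S x = \<kappa> *\<^sub>C x \<Longrightarrow> x \<in> complex_vector.span {e \<kappa>}"
    by metis
  have "finite K"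
    using fin by (simp add: K_def)
  have "x \<in> complex_vector.span (e ` K)" for x
  proof (rule poly_op_kernel_subset_span [OF S(1) \<open>finite K\<close> e])
    show "poly_op S (\<Prod>\<kappa>\<in>K. [:- \<kappa>, 1:]) x = 0"
    proof (rule poly_op_spectrum_eq_0 [OF S \<open>finite K\<close>])
      show "K \<noteq> {}" by (simp add: K_def)
      show "K \<subseteq> \<real>"
        using spectrum_real by (auto simp: K_def s_def intro!: Reals_divide Reals_diff)
      show "bounded_below (\<lambda>x. S x - r *\<^sub>C x)" if "r \<notin> K" for r
        unfolding S_def
      proof (rule bounded_below_R_shift [OF s])
        show "r \<noteq> 0"
          using that by (auto simp: K_def)
        show "s - 1 / r \<in> resolvent_set D A"
        proof (rule ccontr)
          assume "s - 1 / r \<notin> resolvent_set D A"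
          then have "1 / (s - (s - 1 / r)) \<in> K"
            unfolding K_def resolvent_set_iff by blast
          then show False
            using that by simp
        qed
      qed
    qed
  qed
  then show ?thesis
    unfolding finite_dimensional_def using \<open>finite K\<close> by blast
qed

text \<open>Otherwise the spectrum would lie in a bounded interval from \<open>l\<close> to its
  upper bound, hence be finite.\<close>

lemma eigenvalue_below:
  assumes "\<not> finite_dimensional (UNIV :: 'a set)"
  obtains m where "m < l" "complex_of_real m \<in> spectrum D A"
proof -
  obtain M where M: "\<And>t. complex_of_real t \<in> spectrum D A \<Longrightarrow> t \<le> M"
    using spectrum_bounded_above by metis
  have "\<exists>m<l. complex_of_real m \<in> spectrum D A"
  proof (rule ccontr)
    assume "\<not> ?thesis"
    then have "spectrum D A \<subseteq> complex_of_real ` {t \<in> {l..M}. complex_of_real t \<in> spectrum D A}"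
      using M spectrum_real by (force simp: Reals_def)
    then have "finite (spectrum D A)"
      using finite_spectrum_interval finite_surj by blast
    then show False
      using assms finite_dimensional_if_finite_spectrum by blast
  qed
  then show thesis
    using that by blast
qed


subsection \<open>The root locus\<close>

text \<open>The rank-one feedback term contributes a real multiple of a squared modulus to the
  quadratic form.\<close>

lemma closed_loop_eigenvalue_real:
  assumes "\<mu> \<in> eigenvalues D (closed_loop A b b k)"
  shows "\<mu> \<in> \<real>"
proof -
  obtain v where v: "v \<in> D" "v \<noteq> 0" "closed_loop A b b k v = \<mu> *\<^sub>C v"
    using assms by (auto simp: eigenvalues_def)
  have "cinner (\<mu> *\<^sub>C v) v = cinner (A v) v - complex_of_real k * (cinner v b * cnj (cinner v b))"
    by (simp add: v(3) [symmetric] closed_loop_def input_op_def output_op_def cinner.diff_left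
        cinner_scaleC_left cinner_commute [of b v])
  also have "\<dots> = cinner (A v) v - complex_of_real (k * (cmod (cinner v b))\<^sup>2)"
    by (simp add: complex_norm_square flip: of_real_power)
  also have "\<dots> \<in> \<real>"
    by (intro Reals_diff quadratic_form_real v(1)) simp
  finally show ?thesis
    by (rule real_if_quadratic_form_real [OF v(2)])
qed

text \<open>The eigenvector equation says that the pencil of \<open>A\<close> maps \<open>v\<close>
  to \<open>(- a) *\<^sub>C b\<close> with \<open>a\<close> equal to \<open>k\<close> times the
  output of \<open>v\<close>. Solving by the resolvent and taking the output gives
  \<open>1 + k * G t = 0\<close>.\<close>

lemma closed_loop_eigenvalue:
  assumes "k > 0" "complex_of_real t \<in> eigenvalues D (closed_loop A b b k)"
  shows "complex_of_real t \<in> resolvent_set D A" "G t = - 1 / k"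
proof -
  obtain v where v: "v \<in> D" "v \<noteq> 0" "closed_loop A b b k v = complex_of_real t *\<^sub>C v"
    using assms(2) by (auto simp: eigenvalues_def)
  define a where "a = complex_of_real k * cinner v b"
  have pencil: "complex_of_real t *\<^sub>C v - A v = (- a) *\<^sub>C b"
    using v(3) by (simp add: a_def closed_loop_def input_op_def output_op_def scaleC_scaleC
        algebra_simps)
  show rho: "complex_of_real t \<in> resolvent_set D A"
  proof (rule ccontr)
    assume "complex_of_real t \<notin> resolvent_set D A"
    then obtain w where w: "w \<in> D" "w \<noteq> 0" "A w = complex_of_real t *\<^sub>C w"
      by (auto simp: resolvent_set_iff spectrum_eq_eigenvalues eigenvalues_def)
    \<comment> \<open>By symmetry the range of the pencil is orthogonal to \<open>w\<close>. Since
      \<open>b\<close> is not, \<open>a\<close> vanishes and \<open>v\<close> is an eigenvector of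
      \<open>A\<close> with output 0.\<close>
    have "cinner ((- a) *\<^sub>C b) w = 0"
      unfolding pencil [symmetric]
      by (simp add: cinner.diff_left cinner_scaleC_left symmetric v(1) w cinner_scaleC_right)
    moreover have "cinner b w \<noteq> 0"
      using eigenvector_output_nonzero [OF w] cinner_commute [of w b] by auto
    ultimately have "a = 0"
      by (simp add: cinner_scaleC_left cinner.minus_left)
    then have "A v = complex_of_real t *\<^sub>C v" "cinner v b = 0"
      using pencil assms(1) by (simp_all add: a_def)
    then show False
      using eigenvector_output_nonzero [OF v(1,2)] by blast
  qed
  have "v = (- a) *\<^sub>C R (complex_of_real t) b"
    using R_pencil [OF rho v(1)] unfolding pencil bounded_clinear_scaleC [OF bounded_clinear_R [OF rho]]
    by simp
  then have "cinner v b = (- a) * complex_of_real (G t)" "a \<noteq> 0"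
    using cinner_R [OF rho] v(2) cinner_scaleC_left by (metis, auto)
  moreover have "cinner v b * (1 + complex_of_real (k * G t)) = cinner v b - (- a) * complex_of_real (G t)"
    by (simp add: a_def algebra_simps)
  ultimately have "cinner v b * (1 + complex_of_real (k * G t)) = 0" "cinner v b \<noteq> 0"
    by (auto simp: a_def)
  then have "complex_of_real (1 + k * G t) = complex_of_real 0"
    by simp
  then have "1 + k * G t = 0"
    using of_real_eq_iff by blast
  then show "G t = - 1 / k"
    using assms(1) by (simp add: field_simps)
qed

text \<open>\<open>h\<close> stands for a branch with real values. The last two conditions are
  restricted to \<open>k > 0\<close>, because at 0 a branch starts at an eigenvalue of
  \<open>A\<close>.\<close>

context
  fixes h :: "real \<Rightarrow> real"
  assumes h_cont: "continuous_on {0..} h"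
    and h_rho: "k > 0 \<Longrightarrow> complex_of_real (h k) \<in> resolvent_set D A"
    and G_h: "k > 0 \<Longrightarrow> G (h k) = - 1 / k"
begin

text \<open>By the intermediate value theorem the branch passes through \<open>t\<close>, and at a
  positive parameter since \<open>t\<close> differs from both end values.\<close>

lemma branch_between:
  assumes "0 \<le> j" "0 \<le> k" "h k < t" "t < h j"
  shows "complex_of_real t \<in> resolvent_set D A"
proof -
  have "\<exists>i>0. h i = t"
  proof (cases "j \<le> k")
    case True
    have "\<exists>i\<ge>j. i \<le> k \<and> h i = t"
      by (rule IVT2') (use assms True in \<open>auto intro: continuous_on_subset [OF h_cont]\<close>)
    then obtain i where "j \<le> i" "h i = t" by blast
    moreover from this have "i \<noteq> 0"
      using assms by auto
    ultimately show ?thesis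
      using assms(1) by (intro exI [of _ i]) auto
  next
    case False
    have "\<exists>i\<ge>k. i \<le> j \<and> h i = t"
      by (rule IVT') (use assms False in \<open>auto intro: continuous_on_subset [OF h_cont]\<close>)
    then obtain i where "k \<le> i" "h i = t" by blast
    moreover from this have "i \<noteq> 0"
      using assms by auto
    ultimately show ?thesis
      using assms(2) by (intro exI [of _ i]) auto
  qed
  then show ?thesis
    using h_rho by blast
qed

text \<open>If the branch rose from \<open>h j\<close> to \<open>h k\<close>, the interval between
  would be free of spectrum and \<open>G\<close> decreasing on it, whereas \<open>- 1 / k\<close>
  exceeds \<open>- 1 / j\<close>.\<close>

lemma branch_decreasing_pos:
  assumes "0 < j" "j < k"
  shows "h k < h j"
proof (rule ccontr)
  assume "\<not> h k < h j"
  moreover have "h k \<noteq> h j"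
    using G_h [of j] G_h [of k] assms by auto
  ultimately have "h j < h k" by simp
  then have "G (h k) < G (h j)"
  proof (rule G_decreasing)
    fix t assume "h j \<le> t" "t \<le> h k"
    then show "complex_of_real t \<in> resolvent_set D A"
      using branch_between [of k j t] h_rho [of j] h_rho [of k] assms
      by (cases "t = h j"; cases "t = h k") auto
  qed
  then show False
    using G_h [of j] G_h [of k] assms by (simp add: field_simps)
qed

text \<open>Continuity extends monotonicity to the start 0; the detour over \<open>k / 2\<close>
  keeps the inequality strict.\<close>

lemma branch_decreasing:
  assumes "0 \<le> j" "j < k"
  shows "h k < h j"
proof (cases "j = 0")
  case True
  have "(h \<longlongrightarrow> h 0) (at 0 within {0..})"
    using h_cont by (simp add: continuous_on_def)
  then have "(h \<longlongrightarrow> h 0) (at_right 0)"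
    by (rule tendsto_within_subset) auto
  moreover have "\<forall>\<^sub>F i in at_right 0. h (k / 2) \<le> h i"
    using eventually_at_right_real [of 0 "k / 2"] assms branch_decreasing_pos [of _ "k / 2"]
    by (auto elim!: eventually_mono intro!: less_imp_le)
  ultimately have "h (k / 2) \<le> h 0"
    by (intro tendsto_lowerbound) auto
  moreover have "h k < h (k / 2)"
    using assms by (intro branch_decreasing_pos) auto
  ultimately show ?thesis
    using True by simp
qed (use assms branch_decreasing_pos in auto)

text \<open>The eigenvalue \<open>m\<close> is a barrier, so the decreasing branch converges to its
  infimum \<open>z\<close>. If \<open>z\<close> is in the resolvent set, continuity gives
  \<open>G z\<close> as the limit of \<open>- 1 / k\<close>, which is 0.\<close>

lemma branch_limit:
  assumes m: "m < h 0" "complex_of_real m \<in> spectrum D A"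
  obtains z where "complex_of_real z \<in> invariant_zeros D A b b" "(h \<longlongrightarrow> z) at_top"
proof -
  \<comment> \<open>Crossing \<open>m\<close> would put \<open>m\<close> in the resolvent set by
    \<open>branch_between\<close>.\<close>
  have low: "m \<le> h k" if "k \<ge> 0" for k
    using branch_between [of 0 k m] m that by (fastforce simp: resolvent_set_iff)
  define z where "z = Inf (h ` {0..})"
  have bdd: "bdd_below (h ` {0..})"
    using low by (intro bdd_belowI [of _ m]) auto
  have z_le: "z \<le> h k" if "k \<ge> 0" for k
    unfolding z_def using that by (intro cInf_lower bdd) auto
  have near: "\<exists>k\<ge>0. h k < y" if "z < y" for y
    using cInf_lessD [of "h ` {0..}" y] that by (auto simp: z_def)
  have z_less: "z < h k" if "k \<ge> 0" for k
    using z_le [of "k + 1"] branch_decreasing [of k "k + 1"] that by simp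
  have lim: "(h \<longlongrightarrow> z) at_top"
  proof (rule order_tendstoI)
    show "\<forall>\<^sub>F k in at_top. a < h k" if "a < z" for a
      using eventually_ge_at_top [of 0] by eventually_elim (use that z_le in fastforce)
    show "\<forall>\<^sub>F k in at_top. h k < a" if a: "z < a" for a
    proof -
      obtain j where j: "j \<ge> 0" "h j < a"
        using near [OF a] by blast
      show ?thesis
        using eventually_gt_at_top [of j]
        by eventually_elim (use j branch_decreasing in \<open>metis less_trans\<close>)
    qed
  qed
  have rho: "complex_of_real t \<in> resolvent_set D A" if t: "z < t" "t < h 1" for t
  proof -
    obtain j where "j \<ge> 0" "h j < t"
      using near [OF t(1)] by blast
    then show ?thesis
      using branch_between [of 1 j t] t(2) by simp
  qed
  have "complex_of_real z \<in> resolvent_set D A"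
  proof (rule ccontr)
    assume "complex_of_real z \<notin> resolvent_set D A"
    then have "complex_of_real z \<in> spectrum D A"
      by (simp add: resolvent_set_iff)
    \<comment> \<open>To the right of an eigenvalue \<open>G\<close> takes a positive value at some
      \<open>t\<close>. The branch gets between \<open>z\<close> and \<open>t\<close>, where
      \<open>G\<close> is even larger, but along the branch \<open>G\<close> is negative.\<close>
    then obtain t where t: "z < t" "t < h 1" "G t > 0"
      using G_positive_right [of z "h 1"] z_less [of 1] rho by (metis zero_le_one)
    have "\<forall>\<^sub>F k in at_top. h k < t \<and> k > 0"
      using order_tendstoD(2) [OF lim t(1)] eventually_gt_at_top [of 0]
      by (rule eventually_conj)
    then obtain k where k: "h k < t" "k > 0"
      by (auto simp: eventually_at_top_linorder)
    have "G t < G (h k)"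
    proof (rule G_decreasing [OF k(1)])
      show "complex_of_real i \<in> resolvent_set D A" if "h k \<le> i" "i \<le> t" for i
        using that t(2) z_less [of k] k(2) by (intro rho) auto
    qed
    moreover have "G (h k) < 0"
      unfolding G_h [OF k(2)] using k(2) by simp
    ultimately show False
      using t(3) by simp
  qed
  moreover from this have "((\<lambda>k. G (h k)) \<longlongrightarrow> G z) at_top"
    by (intro isCont_tendsto_compose [OF isCont_G lim])
  moreover have "((\<lambda>k. G (h k)) \<longlongrightarrow> 0) at_top"
  proof (rule Lim_transform_eventually)
    show "((\<lambda>k :: real. - 1 / k) \<longlongrightarrow> 0) at_top"
      by (intro tendsto_divide_0 [OF tendsto_const] filterlim_at_top_imp_at_infinity filterlim_ident)
    show "\<forall>\<^sub>F k in at_top. - 1 / k = G (h k)"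
      using eventually_gt_at_top [of 0] by eventually_elim (simp add: G_h)
  qed
  ultimately have "complex_of_real z \<in> invariant_zeros D A b b"
    unfolding invariant_zero_iff
    using tendsto_unique [OF trivial_limit_at_top_linorder] by blast
  then show thesis
    using lim by (rule that)
qed

end

section \<open>From real branches to the root locus\<close>

lemma root_locus_real:
  assumes "root_locus D A b b I f" "n \<in> I" "k \<ge> 0"
  shows "f n k \<in> \<real>"
proof (rule closed_loop_eigenvalue_real)
  show "f n k \<in> eigenvalues D (closed_loop A b b k)"
    using eigenvalues_listed [of D "closed_loop A b b k" I "\<lambda>n. f n k" n] assms
    by (simp add: root_locus_def)
qed

lemma root_locus_converges_left:
  assumes infinite_dim: "\<not> finite_dimensional (UNIV :: 'a set)"
    and rl: "root_locus D A b b I f" and n: "n \<in> I"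
  obtains z where "z \<in> invariant_zeros D A b b" "converges_left (f n) z"
proof -
  define h where "h k = Re (f n k)" for k
  have f: "f n k = complex_of_real (h k)" if "k \<ge> 0" for k
    using root_locus_real [OF rl n that] by (simp add: h_def)
  have eig: "complex_of_real (h k) \<in> eigenvalues D (closed_loop A b b k)" if "k \<ge> 0" for k
    using eigenvalues_listed [OF _ n, of D "closed_loop A b b k" "\<lambda>n. f n k"] rl that f [OF that]
    by (auto simp: root_locus_def)
  have h_cont: "continuous_on {0..} h"
    unfolding h_def using rl n by (intro continuous_intros) (auto simp: root_locus_def)
  have h_rho: "complex_of_real (h k) \<in> resolvent_set D A" and G_h: "G (h k) = - 1 / k" if "k > 0" for k
    using closed_loop_eigenvalue [OF that eig] that by auto
  obtain m where "m < h 0" "complex_of_real m \<in> spectrum D A"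
    by (rule eigenvalue_below [OF infinite_dim])
  then obtain z where z: "complex_of_real z \<in> invariant_zeros D A b b" "(h \<longlongrightarrow> z) at_top"
    using branch_limit [OF h_cont h_rho G_h] by metis
  have "(f n \<longlongrightarrow> complex_of_real z) at_top"
  proof (rule Lim_transform_eventually)
    show "((\<lambda>k. complex_of_real (h k)) \<longlongrightarrow> complex_of_real z) at_top"
      by (intro tendsto_of_real z)
    show "\<forall>\<^sub>F k in at_top. complex_of_real (h k) = f n k"
      using eventually_ge_at_top [of 0] by eventually_elim (simp add: f)
  qed
  then have "converges_left (f n) (complex_of_real z)"
    using branch_decreasing [OF h_cont h_rho G_h] f by (simp add: converges_left_def)
  with z(1) show thesis by (rule that)
qed

end

lemma collocated_siso_if_collocated_self_adjoint:
  assumes "siso_system D A b c" "collocated_self_adjoint D A b c" "minimal_system D A b c"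
  shows "c = b" "collocated_siso D A b"
proof -
  \<comment> \<open>The collocation identity is tested on \<open>b - c\<close>, so that the squared
    norm of \<open>b - c\<close> comes out as 0.\<close>
  have "cinner (input_op b 1) (b - c) = cinner 1 (output_op c (b - c))"
    using assms(2) unfolding collocated_self_adjoint_def by blast
  then have "cinner b (b - c) = cnj (cinner (b - c) c)"
    by (simp add: input_op_def output_op_def cinner_complex_def scaleC_one)
  also have "\<dots> = cinner c (b - c)"
    by (rule cinner_commute [symmetric])
  finally have "cinner (b - c) (b - c) = 0"
    by (simp add: cinner.diff_left [of b c])
  then show "c = b"
    by (simp add: cinner_eq_self_iff)
  have "cinner (A x) y = cinner x (A y)" if "x \<in> D" "y \<in> D" for x y
    using assms(2) that
    by (auto simp: collocated_self_adjoint_def self_adjoint_def adjoint_value_def)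
  then show "collocated_siso D A b"
    using assms \<open>c = b\<close>
    by unfold_locales (auto simp: siso_system_def collocated_self_adjoint_def self_adjoint_def)
qed

theorem theorem5p2:
  fixes D :: "'a :: complex_hilbert set" and A :: "'a \<Rightarrow> 'a" and b c :: 'a
  assumes "siso_system D A b c"
    and "collocated_self_adjoint D A b c"
    and "minimal_system D A b c"
  shows "(\<forall>I f. root_locus D A b c I f \<longrightarrow> (\<forall>n\<in>I. \<forall>k\<ge>0. f n k \<in> \<real>)) \<and>
    invariant_zeros D A b c \<subseteq> \<real> \<and>
    interlace (invariant_zeros D A b c) (eigenvalues D A) \<and>
    (\<not> finite_dimensional (UNIV :: 'a set) \<longrightarrow>
      (\<forall>I f. root_locus D A b c I f \<longrightarrow>
        (\<forall>n\<in>I. \<not> filterlim (\<lambda>k. cmod (f n k)) at_top at_top) \<and>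
        (\<forall>n\<in>I. \<exists>z\<in>invariant_zeros D A b c. converges_left (f n) z)))"
proof -
  have [simp]: "c = b"
    by (rule collocated_siso_if_collocated_self_adjoint [OF assms])
  interpret collocated_siso D A b
    by (rule collocated_siso_if_collocated_self_adjoint [OF assms])
  have "\<not> filterlim (\<lambda>k. cmod (g k)) at_top at_top" if "converges_left g z" for g z
  proof
    assume "filterlim (\<lambda>k. cmod (g k)) at_top at_top"
    moreover have "((\<lambda>k. cmod (g k)) \<longlongrightarrow> cmod z) at_top"
      using that by (auto simp: converges_left_def intro: tendsto_norm)
    ultimately show False
      using not_tendsto_and_filterlim_at_infinity [OF trivial_limit_at_top_linorder]
        filterlim_at_top_imp_at_infinity by blast
  qed
  moreover have "\<exists>z\<in>invariant_zeros D A b b. converges_left (f n) z"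
    if "\<not> finite_dimensional (UNIV :: 'a set)" "root_locus D A b b I f" "n \<in> I" for I f n
    using root_locus_converges_left [OF that] by blast
  ultimately show ?thesis
    using root_locus_real invariant_zeros_real interlacing by simp blast
qed

end
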